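(* Let $n=3$, let $\mathcal{M}\subset\mathrm{Sym}(3)$ be the set of real symmetric $3\times 3$ matrices having a multiple eigenvalue, and let $\mathcal{M}_0=\{X\in\mathcal{M}\mid \mathrm{trace}(X)=0\}$. (1) The singular points of $\mathcal{M}$ are the scalar matrices and only them. (2) $\mathcal{M}$ is the straight cylinder over $\mathcal{M}_0$ having the line of scalar matrices as element. The surface $\mathcal{M}_0$ is 3-dimensional, lies in a 5-dimensional space, and has the following structure. (2.1) $\mathcal{M}_0$ is the cone with zero as vertex over the orbit of the matrix $\mathrm{diag}(1,1,-2)$. This 2-dimensional orbit lies on a 4-dimensional sphere with center zero. (2.2) The orbit of each non-scalar matrix in $\mathcal{M}$ is a 2-dimensional algebraic surface lying on a 4-dimensional sphere. It is diffeomorphic to the projective plane $\mathbb{R}P(2)$. (3) The orbit of each matrix in $\mathcal{M}$ is obtained from the orbit of the matrix $D=\mathrm{diag}(1,1,-2)$ by some scalar shift and some homothety. (4) The set of diagonal matrices in $\mathcal{M}_0$ consists of the three straight lines, intersecting in zero, parameterized respectively by $\lambda\in\mathbb{R}$ as $\mathrm{diag}(\lambda,\lambda,-2\lambda)$, $\mathrm{diag}(\lambda,-2\lambda,\lambda)$, $\mathrm{diag}(-2\lambda,\lambda,\lambda)$.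
   Context: $\mathrm{Sym}(3)$ is the 6-dimensional space of real symmetric $3\times3$ matrices with the Euclidean inner product $\langle X,Y\rangle=\sum_{i,j}x_{i,j}y_{i,j}$; spheres, orthogonality and straight cylinders are understood with respect to it. $\mathcal{M}$ is the zero set of the discriminant of the characteristic polynomial. The orbit of $A\in\mathrm{Sym}(3)$ is $\mathrm{Orbit}(A)=\{gAg^{*}\mid g\in\mathrm{SO}(3)\}$ ($g^{*}$ the transpose). $E$ is the identity matrix; scalar matrices are the matrices $cE$, $c\in\mathbb{R}$. "Straight cylinder over $\mathcal{M}_0$ having the line of scalar matrices as element" means that $\mathcal{M}_0$ lies in a hyperplane orthogonal to that line and $\mathcal{M}=\{X+cE\mid X\in\mathcal{M}_0, c\in\mathbb{R}\}$. "The cone with vertex zero over a set $S$" means $\{tX\mid t\in\mathbb{R},\ X\in S\}$. A scalar shift is a map $X\mapsto X+cE$ with $c\in\mathbb{R}$; a homothety is a map $X\mapsto bX$ with $b\in\mathbb{R}$ ($b=0$ is allowed, as needed for orbits of scalar matrices). An algebraic surface is a common zero set of real polynomials in the matrix entries. A point of a surface is regular if it has a neighbourhood in the surface that is a smooth submanifold of the ambient space (in particular is diffeomorphic to a ball, of dimension 4 for $\mathcal{M}$); otherwise it is singular. *)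

theory Defs
  imports
    "HOL-Analysis.Analysis"
    "HOL-Computational_Algebra.Polynomial"
begin

section \<open>Smooth maps and submanifolds of Euclidean spaces\<close>

text \<open>Meaningful for open \<open>S\<close> only: all iterated directional derivatives of \<open>f\<close> up to
  order \<open>k\<close> exist (as values of Frechet derivatives) and are continuous on \<open>S\<close>.\<close>

primrec Ck_on ::
    "nat \<Rightarrow> 'a::euclidean_space set \<Rightarrow> ('a \<Rightarrow> 'b::real_normed_vector) \<Rightarrow> bool" where
  "Ck_on 0 S f \<longleftrightarrow> continuous_on S f"
| "Ck_on (Suc k) S f \<longleftrightarrow>
     f differentiable_on S \<and> (\<forall>v. Ck_on k S (\<lambda>x. frechet_derivative f (at x) v))"

text \<open>Smoothness of a map on an arbitrary subset: locally it is the restriction of a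
  \<open>C\<^sup>\<infinity>\<close> map defined on an open set of the surrounding Euclidean space.\<close>

definition smooth_on ::
    "'a::euclidean_space set \<Rightarrow> ('a \<Rightarrow> 'b::real_normed_vector) \<Rightarrow> bool" where
  "smooth_on X f \<longleftrightarrow>
     (\<forall>x\<in>X. \<exists>W g. open W \<and> x \<in> W \<and> (\<forall>k. Ck_on k W g) \<and> (\<forall>y\<in>W \<inter> X. g y = f y))"

definition diffeo_betw ::
    "('a::euclidean_space \<Rightarrow> 'b::euclidean_space) \<Rightarrow> 'a set \<Rightarrow> 'b set \<Rightarrow> bool" where
  "diffeo_betw f X Y \<longleftrightarrow>
     bij_betw f X Y \<and> smooth_on X f \<and> smooth_on Y (inv_into X f)"

text \<open>Being a \<open>d\<close>-dimensional smooth submanifold means being locally diffeomorphic to open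
  subsets of \<open>\<real>\<^sup>d\<close>.  Since \<open>d\<close> has to be a term and not a type, \<open>\<real>\<^sup>d\<close> is represented by a
  \<open>d\<close>-dimensional subspace \<open>L\<close> of the type \<open>'a\<close>.  The notion is insensitive to replacing
  the surrounding space by a linear subspace containing \<open>M\<close>, so it may be used for subsets
  of the space of symmetric matrices.\<close>

definition smooth_submanifold :: "nat \<Rightarrow> 'a::euclidean_space set \<Rightarrow> bool" where
  "smooth_submanifold d M \<longleftrightarrow>
     (\<forall>p\<in>M. \<exists>U L (\<phi> :: 'a \<Rightarrow> 'a).
        p \<in> U \<and> openin (top_of_set M) U \<and>
        subspace L \<and> dim L = d \<and> openin (top_of_set L) (\<phi> ` U) \<and>
        diffeo_betw \<phi> U (\<phi> ` U))"

definition regular_point_dim :: "nat \<Rightarrow> 'a::euclidean_space set \<Rightarrow> 'a \<Rightarrow> bool" where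
  "regular_point_dim d S p \<longleftrightarrow>
     (\<exists>U. p \<in> U \<and> openin (top_of_set S) U \<and> smooth_submanifold d U)"

definition regular_point :: "'a::euclidean_space set \<Rightarrow> 'a \<Rightarrow> bool" where
  "regular_point S p \<longleftrightarrow> (\<exists>d. regular_point_dim d S p)"

definition singular_points :: "'a::euclidean_space set \<Rightarrow> 'a set" where
  "singular_points S = {p \<in> S. \<not> regular_point S p}"

text \<open>The dimension of a surface that may have singular points: the points at which the
  surface is a \<open>d\<close>-dimensional submanifold are dense in it.\<close>

definition surface_of_dim :: "nat \<Rightarrow> 'a::euclidean_space set \<Rightarrow> bool" where
  "surface_of_dim d S \<longleftrightarrow> S \<noteq> {} \<and> S \<subseteq> closure {p \<in> S. regular_point_dim d S p}"

section \<open>Smooth structures given by atlases\<close>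

type_synonym ('p, 'e) chart = "'p set \<times> ('p \<Rightarrow> 'e)"

definition smooth_atlas :: "'p set \<Rightarrow> ('p, 'e::euclidean_space) chart set \<Rightarrow> bool" where
  "smooth_atlas M \<A> \<longleftrightarrow>
     (\<Union>(U, \<phi>)\<in>\<A>. U) = M \<and>
     (\<forall>(U, \<phi>)\<in>\<A>. inj_on \<phi> U \<and> open (\<phi> ` U)) \<and>
     (\<forall>(U, \<phi>)\<in>\<A>. \<forall>(V, \<psi>)\<in>\<A>.
        open (\<phi> ` (U \<inter> V)) \<and> smooth_on (\<phi> ` (U \<inter> V)) (\<psi> \<circ> inv_into U \<phi>))"

text \<open>Openness of \<open>\<phi> ` (U \<inter> f -` V)\<close> for all charts, together with smoothness in charts,
  includes the continuity of \<open>f\<close> for the topologies induced by the atlases.\<close>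

definition smooth_map ::
    "('p, 'e::euclidean_space) chart set \<Rightarrow> ('q, 'f::euclidean_space) chart set \<Rightarrow>
     ('p \<Rightarrow> 'q) \<Rightarrow> bool" where
  "smooth_map \<A> \<B> f \<longleftrightarrow>
     (\<forall>(U, \<phi>)\<in>\<A>. \<forall>(V, \<psi>)\<in>\<B>.
        open (\<phi> ` (U \<inter> f -` V)) \<and>
        smooth_on (\<phi> ` (U \<inter> f -` V)) (\<psi> \<circ> f \<circ> inv_into U \<phi>))"

definition diffeomorphic ::
    "'p set \<Rightarrow> ('p, 'e::euclidean_space) chart set \<Rightarrow>
     'q set \<Rightarrow> ('q, 'f::euclidean_space) chart set \<Rightarrow> bool" where
  "diffeomorphic M \<A> N \<B> \<longleftrightarrow>
     smooth_atlas M \<A> \<and> smooth_atlas N \<B> \<and>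
     (\<exists>f. bij_betw f M N \<and> smooth_map \<A> \<B> f \<and> smooth_map \<B> \<A> (inv_into M f))"

text \<open>All charts of a submanifold of a Euclidean space with values in \<open>'e\<close>.\<close>

definition submanifold_charts ::
    "'a::euclidean_space set \<Rightarrow> ('a, 'e::euclidean_space) chart set" where
  "submanifold_charts M =
     {(U, \<phi>). openin (top_of_set M) U \<and> open (\<phi> ` U) \<and> diffeo_betw \<phi> U (\<phi> ` U)}"

text \<open>The real projective plane, as the set of lines through the origin of \<open>\<real>\<^sup>3\<close>, with its
  three affine charts \<open>[x\<^sub>1 : x\<^sub>2 : x\<^sub>3] \<mapsto> (x\<^sub>j / x\<^sub>i, x\<^sub>k / x\<^sub>i)\<close>.\<close>

definition RP2 :: "(real^3) set set" where
  "RP2 = {L. subspace L \<and> dim L = 1}"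

definition RP2_chart :: "3 \<Rightarrow> 3 \<Rightarrow> 3 \<Rightarrow> ((real^3) set, real^2) chart" where
  "RP2_chart i j k =
     ({L \<in> RP2. \<exists>x\<in>L. x $ i \<noteq> 0},
      \<lambda>L. let x = (THE x. x \<in> L \<and> x $ i = 1) in vector [x $ j, x $ k])"

definition RP2_atlas :: "((real^3) set, real^2) chart set" where
  "RP2_atlas = {RP2_chart 1 2 3, RP2_chart 2 1 3, RP2_chart 3 1 2}"

section \<open>Spheres, cones, cylinders and algebraic surfaces\<close>

text \<open>A \<open>k\<close>-dimensional sphere inside \<open>X\<close> is a sphere in a \<open>(k+1)\<close>-dimensional affine
  subspace of \<open>X\<close> through its center.\<close>

definition sphere_of_dim ::
    "'a::euclidean_space set \<Rightarrow> nat \<Rightarrow> 'a \<Rightarrow> 'a set \<Rightarrow> bool" where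
  "sphere_of_dim X k c S \<longleftrightarrow>
     (\<exists>V r. affine V \<and> V \<subseteq> X \<and> c \<in> V \<and> aff_dim V = int k + 1 \<and> r > 0 \<and>
            S = sphere c r \<inter> V)"

text \<open>In contrast to the library's \<open>cone\<close>, negative factors are allowed.\<close>

definition full_cone :: "'a::real_vector set \<Rightarrow> 'a set" where
  "full_cone S = {t *\<^sub>R X | t X. X \<in> S}"

text \<open>\<open>M\<close> is the straight cylinder over \<open>M0\<close> whose element is the line spanned by \<open>e\<close>.\<close>

definition straight_cylinder_over :: "'a::real_inner set \<Rightarrow> 'a \<Rightarrow> 'a set \<Rightarrow> bool" where
  "straight_cylinder_over M0 e M \<longleftrightarrow>
     e \<noteq> 0 \<and> (\<exists>b. M0 \<subseteq> {X. e \<bullet> X = b}) \<and> M = {X + c *\<^sub>R e | X c. X \<in> M0}"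

definition algebraic_surface_in :: "'a::real_normed_vector set \<Rightarrow> 'a set \<Rightarrow> bool" where
  "algebraic_surface_in X S \<longleftrightarrow>
     (\<exists>P. (\<forall>p\<in>P. real_polynomial_function p) \<and> S = {x \<in> X. \<forall>p\<in>P. p x = 0})"

section \<open>Symmetric matrices\<close>

text \<open>The inner product of \<open>real^'n^'n\<close> is the sum of the products of the entries.\<close>

definition Sym :: "(real^'n^'n) set" where
  "Sym = {A. transpose A = A}"

definition charpoly :: "real^'n^'n \<Rightarrow> real poly" where
  "charpoly A = det (\<chi> i j. (if i = j then [:0, 1:] else 0) - [:A $ i $ j:])"

definition has_multiple_eigenvalue :: "real^'n^'n \<Rightarrow> bool" where
  "has_multiple_eigenvalue A \<longleftrightarrow> (\<exists>x. order x (charpoly A) \<ge> 2)"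

definition \<M> :: "(real^3^3) set" where
  "\<M> = {A \<in> Sym. has_multiple_eigenvalue A}"

definition \<M>\<^sub>0 :: "(real^3^3) set" where
  "\<M>\<^sub>0 = {X \<in> \<M>. trace X = 0}"

definition Orbit :: "real^3^3 \<Rightarrow> (real^3^3) set" where
  "Orbit A = {g ** A ** transpose g | g. rotation_matrix g}"

definition scalar_matrices :: "(real^'n^'n) set" where
  "scalar_matrices = range (\<lambda>c. c *\<^sub>R mat 1)"

definition scalar_shift :: "real \<Rightarrow> real^'n^'n \<Rightarrow> real^'n^'n" where
  "scalar_shift c X = X + c *\<^sub>R mat 1"

definition homothety :: "real \<Rightarrow> 'a::real_vector \<Rightarrow> 'a" where
  "homothety b X = b *\<^sub>R X"

definition diag3 :: "real \<Rightarrow> real \<Rightarrow> real \<Rightarrow> real^3^3" where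
  "diag3 a b c = (\<chi> i j. if i = j then vector [a, b, c] $ i else 0)"

definition diagonal_matrix :: "real^'n^'n \<Rightarrow> bool" where
  "diagonal_matrix A \<longleftrightarrow> (\<forall>i j. i \<noteq> j \<longrightarrow> A $ i $ j = 0)"

end

theory Submission
  imports Defs
begin

text \<open>
  A symmetric matrix \<open>A\<close> has a double eigenvalue \<open>a\<close> iff \<open>A = a E + b v v\<^sup>T\<close> for some unit vector
  \<open>v\<close>: a double root makes the determinant and the trace of the cofactor matrix of \<open>A - a E\<close>
  vanish, and by symmetry this kills all cofactors.  Conjugation by a rotation \<open>g\<close> just replaces
  \<open>v\<close> by \<open>g v\<close>, so orbits consist of the matrices \<open>a E + b w w\<^sup>T\<close> with \<open>w\<close> on the unit sphere,
  that is, with \<open>w\<close> up to sign.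

  If \<open>b \<noteq> 0\<close>, then \<open>a\<close> and \<open>b\<close> are rational functions of \<open>A\<close>, and affine coordinates of the line
  spanned by \<open>v\<close> are quotients of entries of \<open>A - a E\<close>.  This gives charts with rational inverses
  for the set of nonscalar matrices with a multiple eigenvalue, for its traceless part and for the
  orbits, and it identifies the orbits with the projective plane.

  At a scalar matrix \<open>c E\<close> the set contains the lines in the directions \<open>e\<^sub>2 e\<^sub>2\<^sup>T\<close> and
  \<open>- e\<^sub>3 e\<^sub>3\<^sup>T\<close>.  If it were a submanifold there, the sum \<open>diag(0, 1, -1)\<close> of these directions would
  be tangent as well.  But the set is closed and invariant under homotheties with center \<open>c E\<close>, so
  \<open>c E + diag(0, 1, -1)\<close> would have a multiple eigenvalue.
\<close>

section \<open>Calculus of smooth maps\<close>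

text \<open>On an open set the derivative at a point depends only on nearby values, so agreement of
  the maps passes to all directional derivatives and the induction can continue.\<close>

lemma Ck_on_cong:
  assumes "open S" "\<And>x. x \<in> S \<Longrightarrow> f x = g x" "Ck_on k S f"
  shows "Ck_on k S g"
  using assms(2,3)
proof (induction k arbitrary: f g)
  case 0
  then show ?case by (metis Ck_on.simps(1) continuous_on_cong)
next
  case (Suc k)
  have der: "(g has_derivative frechet_derivative f (at x)) (at x)" if "x \<in> S" for x
  proof (rule has_derivative_transform_within_open)
    show "(f has_derivative frechet_derivative f (at x)) (at x)"
      using Suc.prems(2) that \<open>open S\<close>
      by (simp add: differentiable_on_eq_differentiable_at flip: frechet_derivative_works)
  qed (use \<open>open S\<close> that Suc.prems in auto)
  then have "g differentiable_on S"
    using \<open>open S\<close> by (auto simp: differentiable_on_eq_differentiable_at differentiable_def)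
  moreover have "Ck_on k S (\<lambda>x. frechet_derivative g (at x) v)" for v
  proof (rule Suc.IH)
    show "frechet_derivative f (at x) v = frechet_derivative g (at x) v" if "x \<in> S" for x
      using frechet_derivative_at[OF der[OF that]] by simp
  qed (use Suc.prems(2) in simp)
  ultimately show ?case by simp
qed

text \<open>Uniqueness of the derivative lets any explicit family \<open>f'\<close> replace
  \<open>frechet_derivative\<close>; together with \<open>Ck_on_SucE\<close> this reduces the
  closure rules below to the usual differentiation formulas.\<close>

lemma Ck_on_SucI:
  assumes "open S" and der: "\<And>x. x \<in> S \<Longrightarrow> (f has_derivative f' x) (at x)"
    and ck: "\<And>v. Ck_on k S (\<lambda>x. f' x v)"
  shows "Ck_on (Suc k) S f"
proof -
  have "f differentiable_on S"
    using \<open>open S\<close> der by (auto simp: differentiable_on_eq_differentiable_at differentiable_def)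
  moreover have "Ck_on k S (\<lambda>x. frechet_derivative f (at x) v)" for v
  proof (rule Ck_on_cong[OF \<open>open S\<close> _ ck[of v]])
    show "f' x v = frechet_derivative f (at x) v" if "x \<in> S" for x
      using frechet_derivative_at[OF der[OF that]] by simp
  qed
  ultimately show ?thesis by simp
qed

lemma Ck_on_SucE:
  assumes "open S" "Ck_on (Suc k) S f"
  obtains f' where "\<And>x. x \<in> S \<Longrightarrow> (f has_derivative f' x) (at x)"
    "\<And>v. Ck_on k S (\<lambda>x. f' x v)"
proof
  show "(f has_derivative frechet_derivative f (at x)) (at x)" if "x \<in> S" for x
    using assms that by (simp add: differentiable_on_eq_differentiable_at flip: frechet_derivative_works)
qed (use assms in simp)

text \<open>Product, quotient and chain rule produce terms that still contain an undifferentiated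
  factor; this lowers its order to the one of the induction hypothesis.\<close>

lemma Ck_on_Suc_imp: "Ck_on (Suc k) S f \<Longrightarrow> Ck_on k S f"
proof (induction k arbitrary: f)
  case 0
  then show ?case by (simp add: differentiable_imp_continuous_on)
next
  case (Suc k)
  then show ?case by (metis Ck_on.simps(2))
qed

lemma Ck_on_subset: "Ck_on k S f \<Longrightarrow> T \<subseteq> S \<Longrightarrow> Ck_on k T f"
  by (induction k arbitrary: f) (auto intro: continuous_on_subset differentiable_on_subset)

lemma Ck_on_const: "open S \<Longrightarrow> Ck_on k S (\<lambda>x. c)"
proof (induction k arbitrary: c)
  case (Suc k)
  then show ?case by (intro Ck_on_SucI[where f' = "\<lambda>_ _. 0"]) auto
qed simp

lemma Ck_on_linear:
  assumes "bounded_linear l" "open S" "Ck_on k S f"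
  shows "Ck_on k S (\<lambda>x. l (f x))"
  using assms(3)
proof (induction k arbitrary: f)
  case 0
  then show ?case using bounded_linear.continuous_on[OF assms(1)] by simp
next
  case (Suc k)
  from Ck_on_SucE[OF assms(2) Suc.prems] obtain f' where
    f': "\<And>x. x \<in> S \<Longrightarrow> (f has_derivative f' x) (at x)" "\<And>v. Ck_on k S (\<lambda>x. f' x v)" by blast
  show ?case
  proof (rule Ck_on_SucI[where f' = "\<lambda>x v. l (f' x v)"])
    show "((\<lambda>x. l (f x)) has_derivative (\<lambda>v. l (f' x v))) (at x)" if "x \<in> S" for x
      by (rule bounded_linear.has_derivative[OF assms(1) f'(1)[OF that]])
  qed (use assms(2) Suc.IH f'(2) in auto)
qed

lemma Ck_on_id: "open S \<Longrightarrow> Ck_on k S (\<lambda>x. x)"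
proof (cases k)
  case (Suc n)
  then show "open S \<Longrightarrow> ?thesis"
    by (auto intro!: Ck_on_SucI[where f' = "\<lambda>_ v. v"] Ck_on_const)
qed simp

lemma Ck_on_add:
  assumes "open S" "Ck_on k S f" "Ck_on k S g"
  shows "Ck_on k S (\<lambda>x. f x + g x)"
  using assms(2,3)
proof (induction k arbitrary: f g)
  case 0
  then show ?case by (simp add: continuous_on_add)
next
  case (Suc k)
  from Ck_on_SucE[OF assms(1) Suc.prems(1)] obtain f' where
    f': "\<And>x. x \<in> S \<Longrightarrow> (f has_derivative f' x) (at x)" "\<And>v. Ck_on k S (\<lambda>x. f' x v)" by blast
  from Ck_on_SucE[OF assms(1) Suc.prems(2)] obtain g' where
    g': "\<And>x. x \<in> S \<Longrightarrow> (g has_derivative g' x) (at x)" "\<And>v. Ck_on k S (\<lambda>x. g' x v)" by blast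
  show ?case
    by (rule Ck_on_SucI[where f' = "\<lambda>x v. f' x v + g' x v"])
      (use assms Suc.IH f' g' in \<open>auto intro: has_derivative_add\<close>)
qed

lemma Ck_on_sum:
  assumes "open S" "\<And>i. i \<in> I \<Longrightarrow> Ck_on k S (f i)"
  shows "Ck_on k S (\<lambda>x. \<Sum>i\<in>I. f i x)"
  using assms(2)
  by (induction I rule: infinite_finite_induct) (auto intro: Ck_on_const Ck_on_add assms(1))

lemma Ck_on_bilinear:
  assumes "bounded_bilinear p" "open S" "Ck_on k S f" "Ck_on k S g"
  shows "Ck_on k S (\<lambda>x. p (f x) (g x))"
  using assms(3,4)
proof (induction k arbitrary: f g)
  case 0
  then show ?case using bounded_bilinear.continuous_on[OF assms(1)] by simp
next
  case (Suc k)
  from Ck_on_SucE[OF assms(2) Suc.prems(1)] obtain f' where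
    f': "\<And>x. x \<in> S \<Longrightarrow> (f has_derivative f' x) (at x)" "\<And>v. Ck_on k S (\<lambda>x. f' x v)" by blast
  from Ck_on_SucE[OF assms(2) Suc.prems(2)] obtain g' where
    g': "\<And>x. x \<in> S \<Longrightarrow> (g has_derivative g' x) (at x)" "\<And>v. Ck_on k S (\<lambda>x. g' x v)" by blast
  show ?case
  proof (rule Ck_on_SucI[where f' = "\<lambda>x v. p (f x) (g' x v) + p (f' x v) (g x)"])
    show "((\<lambda>x. p (f x) (g x)) has_derivative (\<lambda>v. p (f x) (g' x v) + p (f' x v) (g x))) (at x)"
      if "x \<in> S" for x
      by (rule bounded_bilinear.FDERIV[OF assms(1) f'(1)[OF that] g'(1)[OF that]])
    show "Ck_on k S (\<lambda>x. p (f x) (g' x v) + p (f' x v) (g x))" for v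
      using Suc.prems[THEN Ck_on_Suc_imp] f'(2) g'(2) by (intro Ck_on_add assms(2) Suc.IH)
  qed (use assms(2) in auto)
qed

text \<open>The derivative of \<open>1 / f\<close> is \<open>- f' / f^2\<close>, a product whose
  factors \<open>1 / f\<close> are covered by the induction hypothesis at the lower order.\<close>

lemma Ck_on_inverse:
  fixes f :: "'a::euclidean_space \<Rightarrow> real"
  assumes "open S" "Ck_on k S f" "\<And>x. x \<in> S \<Longrightarrow> f x \<noteq> 0"
  shows "Ck_on k S (\<lambda>x. inverse (f x))"
  using assms(2)
proof (induction k)
  case 0
  then show ?case using assms(3) by (simp add: continuous_on_inverse)
next
  case (Suc k)
  from Ck_on_SucE[OF assms(1) Suc.prems(1)] obtain f' where
    f': "\<And>x. x \<in> S \<Longrightarrow> (f has_derivative f' x) (at x)" "\<And>v. Ck_on k S (\<lambda>x. f' x v)" by blast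
  show ?case
  proof (rule Ck_on_SucI[where f' = "\<lambda>x v. - (inverse (f x) * f' x v * inverse (f x))"])
    show "Ck_on k S (\<lambda>x. - (inverse (f x) * f' x v * inverse (f x)))" for v
      using Suc.IH[OF Ck_on_Suc_imp[OF Suc.prems]] f'(2) assms(1)
      by (intro Ck_on_linear[OF bounded_linear_minus[OF bounded_linear_ident]]
          Ck_on_bilinear[OF bounded_bilinear_mult])
    show "((\<lambda>x. inverse (f x)) has_derivative
        (\<lambda>v. - (inverse (f x) * f' x v * inverse (f x)))) (at x)" if "x \<in> S" for x
      by (rule Deriv.has_derivative_inverse[OF assms(3)[OF that] f'(1)[OF that]])
  qed (use assms(1) in auto)
qed

text \<open>In the chain rule the direction \<open>f' x v\<close> fed into \<open>g'\<close> varies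
  with \<open>x\<close>, whereas the induction hypothesis speaks of fixed directions. Expanding
  \<open>f' x v\<close> in the standard basis leaves the maps \<open>g' (f x) b\<close> with fixed
  \<open>b\<close>, multiplied by coordinates of \<open>f' x v\<close>.\<close>

lemma Ck_on_compose:
  fixes f :: "'a::euclidean_space \<Rightarrow> 'b::euclidean_space" and g :: "'b \<Rightarrow> 'c::real_normed_vector"
  assumes "open S" "open T" "f ` S \<subseteq> T" "Ck_on k S f" "Ck_on k T g"
  shows "Ck_on k S (\<lambda>x. g (f x))"
  using assms(4,5)
proof (induction k arbitrary: g)
  case 0
  then show ?case using assms(3) by (auto intro: continuous_on_compose2)
next
  case (Suc k)
  from Ck_on_SucE[OF assms(1) Suc.prems(1)] obtain f' where
    f': "\<And>x. x \<in> S \<Longrightarrow> (f has_derivative f' x) (at x)" "\<And>v. Ck_on k S (\<lambda>x. f' x v)" by blast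
  from Ck_on_SucE[OF assms(2) Suc.prems(2)] obtain g' where
    g': "\<And>x. x \<in> T \<Longrightarrow> (g has_derivative g' x) (at x)" "\<And>v. Ck_on k T (\<lambda>x. g' x v)" by blast
  have expand: "g' (f x) w = (\<Sum>b\<in>Basis. (w \<bullet> b) *\<^sub>R g' (f x) b)" if "x \<in> S" for x w
  proof -
    have "f x \<in> T" using that assms(3) by blast
    then have "linear (g' (f x))" by (rule has_derivative_linear[OF g'(1)])
    from linear_sum[OF this, of "\<lambda>b. (w \<bullet> b) *\<^sub>R b" Basis] linear_cmul[OF this]
    show ?thesis by (simp only: euclidean_representation)
  qed
  show ?case
  proof (rule Ck_on_SucI[where f' = "\<lambda>x v. \<Sum>b\<in>Basis. (f' x v \<bullet> b) *\<^sub>R g' (f x) b"])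
    show "((\<lambda>x. g (f x)) has_derivative (\<lambda>v. \<Sum>b\<in>Basis. (f' x v \<bullet> b) *\<^sub>R g' (f x) b)) (at x)"
      if "x \<in> S" for x
    proof -
      have "f x \<in> T" using that assms(3) by blast
      have "(\<lambda>v. g' (f x) (f' x v)) = (\<lambda>v. \<Sum>b\<in>Basis. (f' x v \<bullet> b) *\<^sub>R g' (f x) b)"
        by (rule ext) (rule expand[OF that])
      with has_derivative_compose[OF f'(1)[OF that] g'(1)[OF \<open>f x \<in> T\<close>]]
      show ?thesis by metis
    qed
    show "Ck_on k S (\<lambda>x. \<Sum>b\<in>Basis. (f' x v \<bullet> b) *\<^sub>R g' (f x) b)" for v
      by (rule Ck_on_sum[OF assms(1)], rule Ck_on_bilinear[OF bounded_bilinear_scaleR assms(1)],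
          rule Ck_on_linear[OF bounded_linear_inner_left assms(1) f'(2)],
          rule Suc.IH[OF Ck_on_Suc_imp[OF Suc.prems(1)] g'(2)])
  qed (use assms(1) in auto)
qed

text \<open>Openness of the domain is bundled in, because \<open>Ck_on\<close> is meaningful on open
  sets only.\<close>

definition Cinf_on :: "'a::euclidean_space set \<Rightarrow> ('a \<Rightarrow> 'b::real_normed_vector) \<Rightarrow> bool" where
  "Cinf_on S f \<longleftrightarrow> open S \<and> (\<forall>k. Ck_on k S f)"

lemma Cinf_on_open: "Cinf_on S f \<Longrightarrow> open S"
  by (simp add: Cinf_on_def)

lemma Cinf_on_continuous: "Cinf_on S f \<Longrightarrow> continuous_on S f"
  unfolding Cinf_on_def by (metis Ck_on.simps(1))

lemma Cinf_on_differentiable: "Cinf_on S f \<Longrightarrow> x \<in> S \<Longrightarrow> f differentiable (at x)"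
  unfolding Cinf_on_def by (metis Ck_on.simps(2) differentiable_on_eq_differentiable_at)

lemma Cinf_on_subset: "Cinf_on S f \<Longrightarrow> open T \<Longrightarrow> T \<subseteq> S \<Longrightarrow> Cinf_on T f"
  unfolding Cinf_on_def by (metis Ck_on_subset)

lemma Cinf_on_compose:
  fixes f :: "'a::euclidean_space \<Rightarrow> 'b::euclidean_space" and g :: "'b \<Rightarrow> 'c::real_normed_vector"
  shows "Cinf_on S f \<Longrightarrow> Cinf_on T g \<Longrightarrow> f ` S \<subseteq> T \<Longrightarrow> Cinf_on S (\<lambda>x. g (f x))"
  unfolding Cinf_on_def by (metis Ck_on_compose)

lemma Cinf_on_linear: "bounded_linear l \<Longrightarrow> Cinf_on S f \<Longrightarrow> Cinf_on S (\<lambda>x. l (f x))"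
  unfolding Cinf_on_def by (metis Ck_on_linear)

lemma Cinf_on_sum:
  "open S \<Longrightarrow> (\<And>i. i \<in> I \<Longrightarrow> Cinf_on S (f i)) \<Longrightarrow> Cinf_on S (\<lambda>x. \<Sum>i\<in>I. f i x)"
  by (simp add: Cinf_on_def Ck_on_sum)

lemma Cinf_on_arith:
  fixes f g :: "'a::euclidean_space \<Rightarrow> 'b::real_normed_vector" and h j :: "'a \<Rightarrow> real"
  shows Cinf_on_const: "open S \<Longrightarrow> Cinf_on S (\<lambda>x. c :: 'b)"
    and Cinf_on_id: "open S \<Longrightarrow> Cinf_on S (\<lambda>x :: 'a. x)"
    and Cinf_on_add: "Cinf_on S f \<Longrightarrow> Cinf_on S g \<Longrightarrow> Cinf_on S (\<lambda>x. f x + g x)"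
    and Cinf_on_diff: "Cinf_on S f \<Longrightarrow> Cinf_on S g \<Longrightarrow> Cinf_on S (\<lambda>x. f x - g x)"
    and Cinf_on_scaleR: "Cinf_on S h \<Longrightarrow> Cinf_on S f \<Longrightarrow> Cinf_on S (\<lambda>x. h x *\<^sub>R f x)"
    and Cinf_on_mult: "Cinf_on S h \<Longrightarrow> Cinf_on S j \<Longrightarrow> Cinf_on S (\<lambda>x. h x * j x)"
    and Cinf_on_divide: "Cinf_on S h \<Longrightarrow> Cinf_on S j \<Longrightarrow> (\<And>x. x \<in> S \<Longrightarrow> j x \<noteq> 0)
      \<Longrightarrow> Cinf_on S (\<lambda>x. h x / j x)"
proof -
  show "open S \<Longrightarrow> Cinf_on S (\<lambda>x. c :: 'b)" "open S \<Longrightarrow> Cinf_on S (\<lambda>x :: 'a. x)"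
    by (simp_all add: Cinf_on_def Ck_on_const Ck_on_id)
  show add: "Cinf_on S f \<Longrightarrow> Cinf_on S g \<Longrightarrow> Cinf_on S (\<lambda>x. f x + g x)"
    for f g :: "'a \<Rightarrow> 'b" by (simp add: Cinf_on_def Ck_on_add)
  show "Cinf_on S f \<Longrightarrow> Cinf_on S g \<Longrightarrow> Cinf_on S (\<lambda>x. f x - g x)"
    using add[OF _ Cinf_on_linear[OF bounded_linear_minus[OF bounded_linear_ident]], of f g] by simp
  show "Cinf_on S h \<Longrightarrow> Cinf_on S f \<Longrightarrow> Cinf_on S (\<lambda>x. h x *\<^sub>R f x)"
    by (simp add: Cinf_on_def Ck_on_bilinear[OF bounded_bilinear_scaleR])
  show mult: "Cinf_on S h \<Longrightarrow> Cinf_on S j \<Longrightarrow> Cinf_on S (\<lambda>x. h x * j x)" for h j :: "'a \<Rightarrow> real"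
    by (simp add: Cinf_on_def Ck_on_bilinear[OF bounded_bilinear_mult])
  show "Cinf_on S h \<Longrightarrow> Cinf_on S j \<Longrightarrow> (\<And>x. x \<in> S \<Longrightarrow> j x \<noteq> 0) \<Longrightarrow> Cinf_on S (\<lambda>x. h x / j x)"
    unfolding divide_inverse by (rule mult) (simp_all add: Cinf_on_def Ck_on_inverse)
qed

lemma Cinf_on_vec_nth: "Cinf_on S f \<Longrightarrow> Cinf_on S (\<lambda>x. f x $ i)"
  by (rule Cinf_on_linear[OF bounded_linear_vec_nth])

lemma bounded_linear_axis: "bounded_linear (axis i :: 'b::real_normed_vector \<Rightarrow> 'b^'n)"
proof (rule bounded_linear_intro[where K = 1])
  show "norm (axis i x :: 'b^'n) \<le> norm x * 1" for x
    using L2_set_le_sum[of UNIV "\<lambda>j. norm ((axis i x :: 'b^'n) $ j)"]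
    by (simp add: norm_vec_def axis_def if_distrib[of norm] cong: if_cong)
qed (auto simp: vec_eq_iff axis_def)

lemma Cinf_on_vec:
  fixes f :: "'a::euclidean_space \<Rightarrow> 'b::real_normed_vector^'n"
  assumes "\<And>i. Cinf_on S (\<lambda>x. f x $ i)"
  shows "Cinf_on S f"
proof -
  have "(\<Sum>i\<in>UNIV. axis i (f x $ i)) = f x" for x
    by (simp add: vec_eq_iff axis_def sum.delta)
  moreover have "Cinf_on S (\<lambda>x. \<Sum>i\<in>UNIV. axis i (f x $ i))"
    using Cinf_on_open[OF assms] assms
    by (intro Cinf_on_sum Cinf_on_linear[OF bounded_linear_axis])
  ultimately show ?thesis by simp
qed

lemma Cinf_on_Pair:
  assumes "Cinf_on S f" "Cinf_on S g"
  shows "Cinf_on S (\<lambda>x. (f x, g x))"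
proof -
  have "bounded_linear (\<lambda>y. (y, 0))" "bounded_linear (\<lambda>y. (0, y))"
    by (auto intro: bounded_linear_Pair bounded_linear_zero bounded_linear_ident)
  from Cinf_on_add[OF Cinf_on_linear[OF this(1) assms(1)] Cinf_on_linear[OF this(2) assms(2)]]
  show ?thesis by simp
qed

section \<open>Smooth maps on arbitrary subsets\<close>

lemma smooth_on_alt:
  "smooth_on X f \<longleftrightarrow> (\<forall>x\<in>X. \<exists>W g. x \<in> W \<and> Cinf_on W g \<and> (\<forall>y\<in>W \<inter> X. g y = f y))"
  unfolding smooth_on_def Cinf_on_def by metis

lemma smooth_onI:
  "Cinf_on W g \<Longrightarrow> X \<subseteq> W \<Longrightarrow> (\<And>x. x \<in> X \<Longrightarrow> f x = g x) \<Longrightarrow> smooth_on X f"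
  unfolding smooth_on_alt by (metis IntD2 subsetD)

lemma smooth_on_cong: "smooth_on X f \<Longrightarrow> (\<And>x. x \<in> X \<Longrightarrow> g x = f x) \<Longrightarrow> smooth_on X g"
  unfolding smooth_on_alt by (metis IntD2)

lemma smooth_on_subset:
  assumes "smooth_on X f" "Y \<subseteq> X"
  shows "smooth_on Y f"
  unfolding smooth_on_alt
proof
  fix x assume "x \<in> Y"
  then have "x \<in> X" using assms(2) by blast
  then obtain W g where W: "x \<in> W" "Cinf_on W g" "\<forall>y\<in>W \<inter> X. g y = f y"
    using assms(1) unfolding smooth_on_alt by blast
  have "\<forall>y\<in>W \<inter> Y. g y = f y" using W(3) assms(2) by (simp add: subset_iff)
  with W(1,2) show "\<exists>W g. x \<in> W \<and> Cinf_on W g \<and> (\<forall>y\<in>W \<inter> Y. g y = f y)"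
    by (intro exI[of _ W] exI[of _ g] conjI)
qed

text \<open>Local extensions \<open>F\<close> and \<open>G\<close> can be composed once the domain
  of \<open>F\<close> is shrunk to the preimage of the domain of \<open>G\<close>, which is open by
  continuity.\<close>

lemma smooth_on_compose:
  fixes f :: "'a::euclidean_space \<Rightarrow> 'b::euclidean_space" and g :: "'b \<Rightarrow> 'c::real_normed_vector"
  assumes f: "smooth_on X f" and g: "smooth_on Y g" and sub: "f ` X \<subseteq> Y"
  shows "smooth_on X (\<lambda>x. g (f x))"
  unfolding smooth_on_alt
proof
  fix x assume x: "x \<in> X"
  then obtain W F where F: "x \<in> W" "Cinf_on W F" "\<forall>y\<in>W \<inter> X. F y = f y"
    using f unfolding smooth_on_alt by blast
  have "f x \<in> Y" using x sub by blast
  then obtain V G where G: "f x \<in> V" "Cinf_on V G" "\<forall>y\<in>V \<inter> Y. G y = g y"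
    using g unfolding smooth_on_alt by blast
  have "open (W \<inter> F -` V)"
    by (rule continuous_open_preimage[OF Cinf_on_continuous[OF F(2)] Cinf_on_open[OF F(2)]
          Cinf_on_open[OF G(2)]])
  from Cinf_on_compose[OF Cinf_on_subset[OF F(2) this] G(2)]
  have "Cinf_on (W \<inter> F -` V) (\<lambda>x. G (F x))" by auto
  moreover have "G (F y) = g (f y)" if "y \<in> (W \<inter> F -` V) \<inter> X" for y
  proof -
    have "F y = f y" using F(3) that by blast
    moreover have "f y \<in> V \<inter> Y" using that sub \<open>F y = f y\<close> by auto
    ultimately show ?thesis using G(3) by metis
  qed
  moreover have "x \<in> W \<inter> F -` V" using F(1,3) G(1) x by auto
  ultimately show "\<exists>W h. x \<in> W \<and> Cinf_on W h \<and> (\<forall>y\<in>W \<inter> X. h y = g (f y))"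
    by (intro exI[of _ "W \<inter> F -` V"] exI[of _ "\<lambda>x. G (F x)"] conjI ballI)
qed

lemma smooth_on_continuous:
  assumes "smooth_on X f"
  shows "continuous_on X f"
  unfolding continuous_on_eq_continuous_within
proof
  fix x assume x: "x \<in> X"
  then obtain W F where F: "x \<in> W" "Cinf_on W F" "\<forall>y\<in>W \<inter> X. F y = f y"
    using assms unfolding smooth_on_alt by blast
  have o: "open W" by (rule Cinf_on_open[OF F(2)])
  have "isCont F x"
    using Cinf_on_continuous[OF F(2)] o F(1) by (simp add: continuous_on_eq_continuous_at)
  then have "continuous (at x within X) F" by (simp add: continuous_at_imp_continuous_at_within)
  moreover have "\<forall>\<^sub>F y in at x within X. F y = f y"
    unfolding eventually_at_topological using o F(1,3) by (intro exI[of _ W]) simp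
  moreover have "F x = f x" using F(1,3) x by blast
  ultimately show "continuous (at x within X) f"
    using Lim_transform_eventually[of F "F x" "at x within X" f] by (simp add: continuous_within)
qed

section \<open>Charts with smooth inverses\<close>

text \<open>Both the chart and its inverse are restrictions of explicit smooth maps on open sets of
  the surrounding spaces, so that a chart can be verified by calculation with formulas instead of
  \<open>inv_into\<close>.\<close>

definition chart_with_inverse ::
    "'a::euclidean_space set \<Rightarrow> 'a set \<Rightarrow> ('a \<Rightarrow> 'e::euclidean_space) \<Rightarrow> 'e set \<Rightarrow> ('e \<Rightarrow> 'a) \<Rightarrow> bool"
  where
  "chart_with_inverse M W \<phi> V \<psi> \<longleftrightarrow>
     Cinf_on W \<phi> \<and> Cinf_on V \<psi> \<and>
     (\<forall>x\<in>M \<inter> W. \<phi> x \<in> V \<and> \<psi> (\<phi> x) = x) \<and> (\<forall>y\<in>V. \<psi> y \<in> M \<inter> W \<and> \<phi> (\<psi> y) = y)"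

lemma chart_with_inverseI:
  assumes "Cinf_on W \<phi>" "Cinf_on V \<psi>"
    and "\<And>x. x \<in> M \<Longrightarrow> x \<in> W \<Longrightarrow> \<phi> x \<in> V" "\<And>x. x \<in> M \<Longrightarrow> x \<in> W \<Longrightarrow> \<psi> (\<phi> x) = x"
    and "\<And>y. y \<in> V \<Longrightarrow> \<psi> y \<in> M" "\<And>y. y \<in> V \<Longrightarrow> \<psi> y \<in> W" "\<And>y. y \<in> V \<Longrightarrow> \<phi> (\<psi> y) = y"
  shows "chart_with_inverse M W \<phi> V \<psi>"
  using assms by (simp add: chart_with_inverse_def)

lemma chart_with_inverse_facts:
  assumes "chart_with_inverse M W \<phi> V \<psi>"
  shows chart_with_inverse_image: "\<phi> ` (M \<inter> W) = V"
    and chart_with_inverse_inj: "inj_on \<phi> (M \<inter> W)"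
    and chart_with_inverse_inv: "y \<in> V \<Longrightarrow> inv_into (M \<inter> W) \<phi> y = \<psi> y"
    and chart_with_inverse_openin: "openin (top_of_set M) (M \<inter> W)"
    and chart_with_inverse_open: "open V"
    and chart_with_inverse_smooth: "smooth_on (M \<inter> W) \<phi>"
proof -
  have \<phi>: "\<phi> x \<in> V" "\<psi> (\<phi> x) = x" if "x \<in> M \<inter> W" for x
    using assms that unfolding chart_with_inverse_def by simp_all
  have \<psi>: "\<psi> y \<in> M \<inter> W" "\<phi> (\<psi> y) = y" if "y \<in> V" for y
    using assms that unfolding chart_with_inverse_def by simp_all
  show "\<phi> ` (M \<inter> W) = V"
  proof
    show "V \<subseteq> \<phi> ` (M \<inter> W)" using \<psi> by (metis image_eqI subsetI)
  qed (use \<phi> in blast)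
  show inj: "inj_on \<phi> (M \<inter> W)" by (rule inj_on_inverseI) (rule \<phi>(2))
  show "inv_into (M \<inter> W) \<phi> y = \<psi> y" if "y \<in> V"
    using inv_into_f_f[OF inj \<psi>(1)[OF that]] \<psi>(2)[OF that] by simp
  have W: "Cinf_on W \<phi>" "Cinf_on V \<psi>" using assms by (simp_all add: chart_with_inverse_def)
  show "openin (top_of_set M) (M \<inter> W)" by (rule openin_open_Int[OF Cinf_on_open[OF W(1)]])
  show "open V" by (rule Cinf_on_open[OF W(2)])
  show "smooth_on (M \<inter> W) \<phi>" by (rule smooth_onI[OF W(1)]) auto
qed

lemma chart_with_inverse_diffeo:
  assumes "chart_with_inverse M W \<phi> V \<psi>"
  shows "diffeo_betw \<phi> (M \<inter> W) V"
proof -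
  have "smooth_on V (inv_into (M \<inter> W) \<phi>)"
    by (rule smooth_onI[of V \<psi>])
      (use assms chart_with_inverse_inv[OF assms] in \<open>auto simp: chart_with_inverse_def\<close>)
  then show ?thesis
    unfolding diffeo_betw_def bij_betw_def
    using chart_with_inverse_facts[OF assms] by simp
qed

lemma smooth_submanifoldI:
  fixes M :: "'a::euclidean_space set"
  assumes charts: "\<And>p. p \<in> M \<Longrightarrow>
      \<exists>W (\<phi> :: 'a \<Rightarrow> 'e::euclidean_space) V \<psi>. p \<in> W \<and> chart_with_inverse M W \<phi> V \<psi>"
    and dim: "DIM('e) \<le> DIM('a)"
  shows "smooth_submanifold DIM('e) M"
proof -
  obtain T :: "'e \<Rightarrow> 'a" where T: "linear T" "\<And>x. norm (T x) = norm x"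
    using isometry_subset_subspace[of "UNIV :: 'e set" "UNIV :: 'a set"] dim
    by (metis UNIV_I dim_UNIV subspace_UNIV)
  have "inj T"
    using T by (metis (no_types) linear_injective_0 norm_eq_zero)
  then obtain T' where T': "linear T'" "T' \<circ> T = id"
    using linear_injective_left_inverse[OF T(1)] by blast
  then have T'T [simp]: "T' (T x) = x" for x by (metis comp_apply id_apply)
  have bl: "bounded_linear T" "bounded_linear T'"
    using T(1) T'(1) by (simp_all add: linear_conv_bounded_linear)
  show ?thesis
    unfolding smooth_submanifold_def
  proof
    fix p assume "p \<in> M"
    then obtain W and \<phi> :: "'a \<Rightarrow> 'e" and V \<psi>
      where p: "p \<in> W" and c: "chart_with_inverse M W \<phi> V \<psi>"
      using charts by blast
    note c_facts = chart_with_inverse_facts[OF c]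
    let ?U = "M \<inter> W" and ?\<phi> = "\<lambda>x. T (\<phi> x)"
    have image: "?\<phi> ` ?U = T ` V" using c_facts(1) by (metis image_image)
    have open_pre: "open (T' -` V)"
      using c_facts(5) by (intro open_vimage linear_continuous_on bl)
    have TV: "T ` V = range T \<inter> T' -` V" by auto
    have inj: "inj_on ?\<phi> ?U"
      using c_facts(2) \<open>inj T\<close> by (simp add: inj_on_def)
    have "smooth_on (T ` V) (inv_into ?U ?\<phi>)"
    proof (rule smooth_onI)
      have C: "Cinf_on V \<psi>" using c by (simp add: chart_with_inverse_def)
      show "Cinf_on (T' -` V) (\<lambda>z. \<psi> (T' z))"
        by (rule Cinf_on_compose[OF Cinf_on_linear[OF bl(2) Cinf_on_id[OF open_pre]] C]) auto
      show "inv_into ?U ?\<phi> z = \<psi> (T' z)" if z: "z \<in> T ` V" for z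
      proof -
        obtain y where y: "y \<in> V" "z = T y" using z by blast
        have "\<psi> y \<in> ?U" "\<phi> (\<psi> y) = y" using c y(1) by (simp_all add: chart_with_inverse_def)
        then show ?thesis using inv_into_f_f[OF inj, of "\<psi> y"] y by simp
      qed
    qed (use TV in blast)
    moreover have "smooth_on ?U ?\<phi>"
      by (rule smooth_onI[OF Cinf_on_linear[OF bl(1)], of W \<phi>])
        (use c in \<open>auto simp: chart_with_inverse_def\<close>)
    ultimately have "diffeo_betw ?\<phi> ?U (?\<phi> ` ?U)"
      unfolding diffeo_betw_def using inj image by (simp add: bij_betw_def)
    moreover have "openin (top_of_set (range T)) (?\<phi> ` ?U)"
      unfolding image TV by (rule openin_open_Int[OF open_pre])
    moreover have "subspace (range T)" "dim (range T) = DIM('e)"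
      using T(1) \<open>inj T\<close> dim_image_eq[OF T(1), of UNIV]
      by (auto simp: linear_subspace_image)
    ultimately show "\<exists>U L (\<phi> :: 'a \<Rightarrow> 'a). p \<in> U \<and> openin (top_of_set M) U \<and> subspace L \<and>
        dim L = DIM('e) \<and> openin (top_of_set L) (\<phi> ` U) \<and> diffeo_betw \<phi> U (\<phi> ` U)"
      using c_facts(4) p \<open>p \<in> M\<close>
      by (intro exI[of _ ?U] exI[of _ "range T"] exI[of _ ?\<phi>] conjI) auto
  qed
qed

text \<open>The image of a relatively open set is its preimage under the continuous inverse
  chart.\<close>

lemma diffeo_betw_open_image:
  assumes d: "diffeo_betw \<phi> U (\<phi> ` U)" and "open (\<phi> ` U)" and "openin (top_of_set U) U'"
  shows "open (\<phi> ` U')"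
proof -
  obtain W where W: "open W" "U' = U \<inter> W" using assms(3) by (auto simp: openin_open)
  have inj: "inj_on \<phi> U" using d by (simp add: diffeo_betw_def bij_betw_def)
  have "continuous_on (\<phi> ` U) (inv_into U \<phi>)"
    using d by (simp add: diffeo_betw_def smooth_on_continuous)
  then have "open (\<phi> ` U \<inter> inv_into U \<phi> -` W)"
    using assms(2) W(1) by (rule continuous_open_preimage)
  also have "\<phi> ` U \<inter> inv_into U \<phi> -` W = \<phi> ` U'"
    using inj W(2) by (auto simp: inv_into_f_f)
  finally show ?thesis .
qed

text \<open>The given charts are needed for the covering only. Any two submanifold charts are
  compatible, since a transition map composes a smooth inverse with a smooth chart.\<close>

lemma smooth_atlas_submanifold_charts:
  fixes M :: "'a::euclidean_space set"
  assumes "\<And>p. p \<in> M \<Longrightarrow>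
    \<exists>W (\<phi> :: 'a \<Rightarrow> 'e::euclidean_space) V \<psi>. p \<in> W \<and> chart_with_inverse M W \<phi> V \<psi>"
  shows "smooth_atlas M (submanifold_charts M :: ('a, 'e) chart set)"
proof -
  let ?A = "submanifold_charts M :: ('a, 'e) chart set"
  have "\<exists>c\<in>?A. p \<in> fst c" if p: "p \<in> M" for p
  proof -
    obtain W and \<phi> :: "'a \<Rightarrow> 'e" and V \<psi>
      where "p \<in> W" and c: "chart_with_inverse M W \<phi> V \<psi>"
      using assms[OF p] by blast
    then have "(M \<inter> W, \<phi>) \<in> submanifold_charts M"
      unfolding submanifold_charts_def
      using chart_with_inverse_facts[OF c] chart_with_inverse_diffeo[OF c] by simp
    then show ?thesis using p \<open>p \<in> W\<close> by force
  qed
  moreover have "fst c \<subseteq> M" if "c \<in> ?A" for c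
    using that openin_imp_subset by (fastforce simp: submanifold_charts_def)
  ultimately have "(\<Union>(U, \<phi>)\<in>?A. U) = M" by (fastforce simp: case_prod_beta)
  moreover have "inj_on \<phi> U \<and> open (\<phi> ` U)" if "(U, \<phi>) \<in> ?A" for U \<phi>
    using that by (auto simp: submanifold_charts_def diffeo_betw_def bij_betw_def)
  moreover have "open (\<phi> ` (U \<inter> V)) \<and> smooth_on (\<phi> ` (U \<inter> V)) (\<psi> \<circ> inv_into U \<phi>)"
    if c: "(U, \<phi>) \<in> ?A" "(V, \<psi>) \<in> ?A" for U \<phi> V \<psi>
  proof -
    have U: "openin (top_of_set M) U" "open (\<phi> ` U)" "diffeo_betw \<phi> U (\<phi> ` U)"
      and V: "openin (top_of_set M) V" "smooth_on V \<psi>"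
      using c by (auto simp: submanifold_charts_def diffeo_betw_def)
    have inj: "inj_on \<phi> U" using U by (simp add: diffeo_betw_def bij_betw_def)
    have sub: "U \<subseteq> M" using U(1) by (rule openin_imp_subset)
    have "openin (top_of_set U) (U \<inter> V)"
      using V(1) sub by (auto simp: openin_open)
    then have "open (\<phi> ` (U \<inter> V))" by (rule diffeo_betw_open_image[OF U(3,2)])
    moreover have "smooth_on (\<phi> ` (U \<inter> V)) (\<lambda>y. \<psi> (inv_into U \<phi> y))"
    proof (rule smooth_on_compose[OF _ V(2)])
      show "smooth_on (\<phi> ` (U \<inter> V)) (inv_into U \<phi>)"
        by (rule smooth_on_subset[of "\<phi> ` U"]) (use U(3) in \<open>auto simp: diffeo_betw_def\<close>)
      show "inv_into U \<phi> ` (\<phi> ` (U \<inter> V)) \<subseteq> V" using inj by (auto simp: inv_into_f_f)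
    qed
    ultimately show ?thesis by (simp add: comp_def)
  qed
  ultimately show ?thesis
    unfolding smooth_atlas_def Ball_def split_paired_All by simp
qed

section \<open>Matrices with a multiple eigenvalue and their orbits\<close>

lemma unit_vec_nonzero: "norm x = 1 \<Longrightarrow> x \<noteq> (0 :: 'a::real_normed_vector)"
  by auto

lemma unit_vec_nth_nonzero: "norm x = 1 \<Longrightarrow> \<exists>i. x $ i \<noteq> (0 :: real)"
  by (metis norm_zero vec_eq_iff zero_index zero_neq_one)

definition outer :: "real^'n \<Rightarrow> real^'n^'n" where
  "outer v = (\<chi> i j. v $ i * v $ j)"

text \<open>For a unit vector \<open>v\<close> this matrix acts as \<open>a\<close> on the
  orthogonal complement of \<open>v\<close> and as \<open>a + b\<close> on the line of
  \<open>v\<close>; so \<open>b\<close> is the gap between the simple and the double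
  eigenvalue.\<close>

definition spike :: "real \<Rightarrow> real \<Rightarrow> real^'n \<Rightarrow> real^'n^'n" where
  "spike a b v = a *\<^sub>R mat 1 + b *\<^sub>R outer v"

lemma outer_nth [simp]: "outer v $ i $ j = v $ i * v $ j"
  by (simp add: outer_def)

lemma spike_nth [simp]: "spike a b v $ i $ j = (if i = j then a else 0) + b * (v $ i * v $ j)"
  by (simp add: spike_def mat_def)

lemma outer_scaleR: "outer (c *\<^sub>R v) = c\<^sup>2 *\<^sub>R outer v"
  by (simp add: vec_eq_iff power2_eq_square)

lemma trace_mat_1: "trace (mat 1 :: real^'n^'n) = real CARD('n)"
  by (simp add: trace_def mat_def)

lemma trace_add: "trace (A + B) = trace A + trace (B :: real^'n^'n)"
  by (simp add: trace_def sum.distrib)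

lemma trace_diff: "trace (A - B) = trace A - trace (B :: real^'n^'n)"
  by (simp add: trace_def sum_subtractf)

lemma trace_scaleR: "trace (c *\<^sub>R A) = c * trace (A :: real^'n^'n)"
  by (simp add: trace_def sum_distrib_left)

lemma trace_outer: "trace (outer v) = v \<bullet> v"
  by (simp add: trace_def inner_vec_def)

lemma trace_spike: "norm v = 1 \<Longrightarrow> trace (spike a b v) = real CARD('n) * a + b"
  for v :: "real^'n" and a b :: real
  by (simp add: spike_def trace_add trace_scaleR trace_mat_1 trace_outer dot_square_norm)

lemma spike_in_Sym: "spike a b v \<in> Sym"
  by (simp add: Sym_def vec_eq_iff transpose_def mult.commute)

lemma Sym_nth: "A \<in> Sym \<Longrightarrow> A $ i $ j = A $ j $ i"
  by (auto simp: Sym_def vec_eq_iff transpose_def)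

text \<open>Vanishing of the two-by-two minors means rank at most one. For a symmetric matrix, a
  nonzero column then spans the image and gives \<open>v\<close>.\<close>

lemma minors_zero_imp_outer:
  fixes B :: "real^'n^'n"
  assumes sym: "B \<in> Sym" and minors: "\<And>i j k l. B $ i $ j * B $ k $ l = B $ i $ l * B $ k $ j"
  obtains v where "norm v = 1" "B = trace B *\<^sub>R outer v"
proof (cases "\<exists>m. B $ m $ m \<noteq> 0")
  case False
  have "B $ i $ j = 0" for i j
  proof -
    have "B $ i $ j * B $ i $ j = 0"
      using minors[of i j j i] False Sym_nth[OF sym, of i j] by simp
    then show ?thesis by simp
  qed
  then have "B = 0" by (simp add: vec_eq_iff)
  \<comment> \<open>The coefficient \<open>trace B\<close> is zero here, so any unit vector
    serves.\<close>
  then have "B = trace B *\<^sub>R outer (axis undefined 1)" by (simp add: trace_def)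
  then show ?thesis using that[of "axis undefined 1"] by simp
next
  case True
  then obtain m where m: "B $ m $ m \<noteq> 0" by blast
  \<comment> \<open>The minors say that \<open>outer w\<close> is \<open>B $ m $ m\<close> times
    \<open>B\<close>. Taking traces gives the squared norm of \<open>w\<close>, and normalizing
    \<open>w\<close> cancels the factor \<open>B $ m $ m\<close>.\<close>
  define w where "w = (\<chi> i. B $ i $ m)"
  have w: "w $ i * w $ j = B $ m $ m * B $ i $ j" for i j
    using minors[of m m i j] Sym_nth[OF sym, of m j] by (simp add: w_def)
  have "w \<bullet> w = B $ m $ m * trace B"
    by (simp add: inner_vec_def w trace_def sum_distrib_left)
  then have n: "(norm w)\<^sup>2 = B $ m $ m * trace B" by (simp add: power2_norm_eq_inner)
  have "w \<noteq> 0" using m by (auto simp: w_def vec_eq_iff)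
  then have "B $ m $ m * trace B \<noteq> 0" using n by (metis norm_eq_zero power_eq_0_iff)
  then have "B = trace B *\<^sub>R outer (w /\<^sub>R norm w)"
    using w n by (simp add: vec_eq_iff outer_scaleR power_inverse field_simps)
  then show ?thesis using that[of "w /\<^sub>R norm w"] \<open>w \<noteq> 0\<close> by simp
qed

lemma poly_charpoly:
  fixes A :: "real^3^3"
  shows "poly (charpoly A) x = det (x *\<^sub>R mat 1 - A)"
  by (simp add: charpoly_def det_3 mat_def algebra_simps)

lemma det_spike:
  fixes v :: "real^3"
  assumes "norm v = 1"
  shows "det (x *\<^sub>R mat 1 - spike a b v) = (x - a)\<^sup>2 * (x - a - b)"
proof -
  have "(v $ 1)\<^sup>2 + (v $ 2)\<^sup>2 + (v $ 3)\<^sup>2 = 1"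
    using assms by (simp add: norm_eq_1 inner_vec_def sum_3 power2_eq_square)
  then show ?thesis by (simp add: det_3 mat_def) algebra
qed

lemma spike_in_\<M>:
  assumes "norm v = 1"
  shows "spike a b v \<in> \<M>"
proof -
  have eq: "charpoly (spike a b v) = [:-a, 1:]\<^sup>2 * [:-(a + b), 1:]"
    by (rule poly_ext) (simp add: poly_charpoly det_spike[OF assms] power2_eq_square algebra_simps)
  then have "[:-a, 1:]\<^sup>2 dvd charpoly (spike a b v)" by (metis dvd_triv_left)
  \<comment> \<open>The zero polynomial is divisible by every power; only for a nonzero polynomial
    does divisibility bound the order from below.\<close>
  moreover have "charpoly (spike a b v) \<noteq> 0"
    unfolding eq by (simp only: mult_eq_0_iff power_eq_0_iff pCons_eq_0_iff) simp
  ultimately have "order a (charpoly (spike a b v)) \<ge> 2" by (simp add: order_divides)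
  then show ?thesis by (auto simp: \<M>_def has_multiple_eigenvalue_def spike_in_Sym)
qed

text \<open>The cofactors \<open>m\<^sub>1, m\<^sub>2, m\<^sub>3\<close> on the diagonal add up to zero, and the product of any two of them is
  the square of an off-diagonal cofactor because the determinant vanishes; so all cofactors vanish.\<close>

lemma double_root_cofactors:
  fixes p q r s t u :: real
  assumes det: "p * q * r + 2 * s * t * u - p * u\<^sup>2 - q * t\<^sup>2 - r * s\<^sup>2 = 0"
    and tr: "p * q + p * r + q * r - s\<^sup>2 - t\<^sup>2 - u\<^sup>2 = 0"
  shows "q * r = u * u" "p * r = t * t" "p * q = s * s" "p * u = s * t" "q * t = s * u" "r * s = t * u"
proof -
  define m1 m2 m3 where m: "m1 = q * r - u * u" "m2 = p * r - t * t" "m3 = p * q - s * s"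
  have sum: "m1 + m2 + m3 = 0" using tr by (simp add: m power2_eq_square)
  have 12: "m1 * m2 = (r * s - t * u)\<^sup>2" and 13: "m1 * m3 = (q * t - s * u)\<^sup>2"
    and 23: "m2 * m3 = (p * u - s * t)\<^sup>2"
    using det unfolding m by algebra+
  \<comment> \<open>Squaring \<open>m1 + m2 + m3 = 0\<close> and rewriting the mixed products as
    squares leaves a vanishing sum of squares.\<close>
  have "m1\<^sup>2 + m2\<^sup>2 + m3\<^sup>2 + 2 * (r * s - t * u)\<^sup>2 + 2 * (q * t - s * u)\<^sup>2 + 2 * (p * u - s * t)\<^sup>2 = 0"
    using sum unfolding 12[symmetric] 13[symmetric] 23[symmetric] by algebra
  then have "m1\<^sup>2 = 0 \<and> m2\<^sup>2 = 0 \<and> m3\<^sup>2 = 0 \<and> (r * s - t * u)\<^sup>2 = 0 \<and> (q * t - s * u)\<^sup>2 = 0 \<and>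
      (p * u - s * t)\<^sup>2 = 0"
    using zero_le_power2[of m1] zero_le_power2[of m2] zero_le_power2[of m3]
      zero_le_power2[of "r * s - t * u"] zero_le_power2[of "q * t - s * u"]
      zero_le_power2[of "p * u - s * t"] by linarith
  then show "q * r = u * u" "p * r = t * t" "p * q = s * s" "p * u = s * t" "q * t = s * u"
    "r * s = t * u" by (simp_all add: m)
qed

lemma \<M>_imp_spike:
  assumes "A \<in> \<M>"
  obtains a b v where "norm v = 1" "A = spike a b v"
proof -
  have sym: "A \<in> Sym" using assms by (simp add: \<M>_def)
  note s = Sym_nth[OF sym]
  obtain x where x: "order x (charpoly A) \<ge> 2"
    using assms by (auto simp: \<M>_def has_multiple_eigenvalue_def)
  then have "[:-x, 1:]\<^sup>2 dvd charpoly A" by (simp add: order_divides)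
  then obtain f where f: "charpoly A = [:-x, 1:]\<^sup>2 * f" by (rule dvdE)
  have root: "poly (charpoly A) x = 0" "poly (pderiv (charpoly A)) x = 0"
    unfolding f power2_eq_square pderiv_mult poly_add poly_mult by simp_all
  have expl: "charpoly A = [:- det A, A$1$1 * A$2$2 + A$1$1 * A$3$3 + A$2$2 * A$3$3
       - (A$1$2)\<^sup>2 - (A$1$3)\<^sup>2 - (A$2$3)\<^sup>2, - (A$1$1 + A$2$2 + A$3$3), 1:]"
    by (rule poly_ext)
      (simp add: poly_charpoly det_3 mat_def s[of 2 1] s[of 3 1] s[of 3 2] power2_eq_square
        algebra_simps)
  \<comment> \<open>These are the diagonal entries of \<open>A - x E\<close>. The next two facts say
    that its determinant vanishes and, from the derivative of the characteristic polynomial, that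
    the sum of its principal two-by-two minors vanishes.\<close>
  define p q r where pqr: "p = A$1$1 - x" "q = A$2$2 - x" "r = A$3$3 - x"
  have d0: "p * q * r + 2 * A$1$2 * A$1$3 * A$2$3 - p * (A$2$3)\<^sup>2 - q * (A$1$3)\<^sup>2 - r * (A$1$2)\<^sup>2 = 0"
    using root(1) unfolding poly_charpoly pqr
    by (simp add: det_3 mat_def s[of 2 1] s[of 3 1] s[of 3 2] power2_eq_square algebra_simps)
  have d1: "p * q + p * r + q * r - (A$1$2)\<^sup>2 - (A$1$3)\<^sup>2 - (A$2$3)\<^sup>2 = 0"
    using root(2) unfolding expl pqr
    by (simp add: pderiv_pCons power2_eq_square algebra_simps)
  define B where "B = A - x *\<^sub>R mat 1"
  have B: "B $ i $ j = A $ i $ j - (if i = j then x else 0)" for i j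
    by (simp add: B_def mat_def)
  have "B \<in> Sym" using s by (simp add: Sym_def vec_eq_iff transpose_def B)
  moreover have "\<forall>i j k l. B $ i $ j * B $ k $ l = B $ i $ l * B $ k $ j"
    using double_root_cofactors[OF d0 d1]
    unfolding forall_3 by (simp add: B pqr s[of 2 1] s[of 3 1] s[of 3 2] mult.commute)
  ultimately obtain v where v: "norm v = 1" "B = trace B *\<^sub>R outer v"
    using minors_zero_imp_outer[of B] by metis
  then have "A = spike x (trace B) v" unfolding spike_def by (simp add: B_def algebra_simps)
  with v(1) show ?thesis by (rule that)
qed

section \<open>Conjugation by rotations and the shape of orbits\<close>

lemma matrix_add_rdistrib: "(A + B) ** C = A ** C + B ** (C :: real^'n^'m)"
  by (simp add: vec_eq_iff matrix_matrix_mult_def sum.distrib distrib_right)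

lemma orthogonal_conj_spike:
  assumes "orthogonal_matrix g"
  shows "g ** spike a b v ** transpose g = spike a b (g *v v)"
proof -
  have "g ** outer v ** transpose g = outer (g *v v)"
    by (simp add: vec_eq_iff matrix_matrix_mult_def matrix_vector_mult_def transpose_def
        sum_distrib_left sum_distrib_right mult_ac)
  moreover have "g ** transpose g = mat 1" using assms by (simp add: orthogonal_matrix_def)
  ultimately show ?thesis
    by (simp add: spike_def matrix_add_ldistrib matrix_add_rdistrib matrix_scalar_ac
        flip: scalar_matrix_assoc)
qed

text \<open>Rotations preserve the unit sphere and act transitively on it.\<close>

lemma Orbit_spike:
  fixes v :: "real^3"
  assumes "norm v = 1"
  shows "Orbit (spike a b v) = {spike a b w | w. norm w = 1}"
proof (intro Set.equalityI subsetI)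
  fix X assume "X \<in> Orbit (spike a b v)"
  then obtain g where g: "rotation_matrix g" "X = g ** spike a b v ** transpose g"
    by (auto simp: Orbit_def)
  then have o: "orthogonal_matrix g" by (simp add: rotation_matrix_def)
  then have "orthogonal_transformation (\<lambda>x. g *v x)"
    by (simp add: orthogonal_transformation_matrix)
  then have "norm (g *v v) = 1" using assms by (simp add: orthogonal_transformation)
  then show "X \<in> {spike a b w | w. norm w = 1}"
    using g(2) orthogonal_conj_spike[OF o] by auto
next
  fix X :: "real^3^3" assume "X \<in> {spike a b w | w. norm w = 1}"
  then obtain w :: "real^3" where w: "norm w = 1" "X = spike a b w" by blast
  obtain f where f: "orthogonal_transformation f" "det (matrix f) = 1" "f v = w"
    using rotation_exists[of v w] assms w(1) by auto
  then have g: "rotation_matrix (matrix f)" "matrix f *v v = w"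
    by (auto simp: rotation_matrix_def orthogonal_transformation_matrix matrix_works)
  then have "X = matrix f ** spike a b v ** transpose (matrix f)"
    using w(2) orthogonal_conj_spike by (metis rotation_matrix_def)
  then show "X \<in> Orbit (spike a b v)" using g(1) by (auto simp: Orbit_def)
qed

section \<open>Rational charts\<close>

lemma Cinf_on_fst: "Cinf_on S f \<Longrightarrow> Cinf_on S (\<lambda>x. fst (f x))"
  by (rule Cinf_on_linear[OF bounded_linear_fst])

lemma Cinf_on_snd: "Cinf_on S f \<Longrightarrow> Cinf_on S (\<lambda>x. snd (f x))"
  by (rule Cinf_on_linear[OF bounded_linear_snd])

lemma Cinf_on_inner:
  "Cinf_on S f \<Longrightarrow> Cinf_on S g \<Longrightarrow> Cinf_on S (\<lambda>x. f x \<bullet> g x)"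
  by (simp add: Cinf_on_def Ck_on_bilinear[OF bounded_bilinear_inner])

lemma Cinf_on_matrix_mult:
  fixes f :: "'a::euclidean_space \<Rightarrow> real^'n^'m"
  assumes "Cinf_on S f" "Cinf_on S g"
  shows "Cinf_on S (\<lambda>x. f x ** g x)"
  by (intro Cinf_on_vec)
    (simp add: matrix_matrix_mult_def Cinf_on_sum Cinf_on_mult Cinf_on_vec_nth assms
      Cinf_on_open[OF assms(1)])

lemma Cinf_on_open_neq_0:
  assumes "Cinf_on S (f :: 'a::euclidean_space \<Rightarrow> real)"
  shows "open {x \<in> S. f x \<noteq> 0}"
proof -
  have "{x \<in> S. f x \<noteq> 0} = S \<inter> f -` (- {0})" by auto
  then show ?thesis
    using continuous_open_preimage[OF Cinf_on_continuous[OF assms] Cinf_on_open[OF assms],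
        of "- {0}"] by (simp add: open_Compl)
qed

lemma Cinf_on_spike:
  assumes "Cinf_on S a" "Cinf_on S b" "Cinf_on S v"
  shows "Cinf_on S (\<lambda>x. spike (a x) (b x) (v x))"
proof (intro Cinf_on_vec)
  fix i j
  have *: "Cinf_on S (\<lambda>x. b x * (v x $ i * v x $ j))"
    using assms by (intro Cinf_on_mult Cinf_on_vec_nth)
  show "Cinf_on S (\<lambda>x. spike (a x) (b x) (v x) $ i $ j)"
    using Cinf_on_add[OF assms(1) *] * by (cases "i = j") simp_all
qed

text \<open>The inverse of an affine chart of the projective plane: the representative of a line
  whose pivot coordinate \<open>i\<close> is one.\<close>

definition aff_vec :: "3 \<Rightarrow> 3 \<Rightarrow> 3 \<Rightarrow> real^2 \<Rightarrow> real^3" where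
  "aff_vec i j k u = (\<chi> l. if l = i then 1 else if l = j then u $ 1 else u $ 2)"

definition aff_coord :: "3 \<Rightarrow> 3 \<Rightarrow> 3 \<Rightarrow> real^3 \<Rightarrow> real^2" where
  "aff_coord i j k x = vector [x $ j / x $ i, x $ k / x $ i]"

text \<open>The equation \<open>{i, j, k} = UNIV\<close> serves throughout as the statement that the
  three indices form a permutation; counting elements makes them distinct.\<close>

lemma triple_distinct:
  assumes "{i, j, k} = (UNIV :: 3 set)"
  shows "i \<noteq> j" "i \<noteq> k" "j \<noteq> k"
  using arg_cong[OF assms, of card] by (auto simp: card_insert_if split: if_splits)

lemma ex_triple: "\<exists>j k. {i, j, k} = (UNIV :: 3 set)"
  using exhaust_3[of i] unfolding UNIV_3 by blast

lemma aff_vec_aff_coord: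
  assumes "{i, j, k} = UNIV" "x $ i \<noteq> 0"
  shows "aff_vec i j k (aff_coord i j k x) = x /\<^sub>R x $ i"
proof -
  have "aff_vec i j k (aff_coord i j k x) $ l = (x /\<^sub>R x $ i) $ l" for l
    using assms triple_distinct[OF assms(1)] UNIV_I[of l]
    unfolding assms(1)[symmetric] by (auto simp: aff_vec_def aff_coord_def divide_inverse)
  then show ?thesis by (simp add: vec_eq_iff)
qed

lemma aff_coord_aff_vec:
  assumes "{i, j, k} = UNIV" "c \<noteq> 0"
  shows "aff_coord i j k (c *\<^sub>R aff_vec i j k u) = u"
  using triple_distinct[OF assms(1)] assms(2)
  by (simp add: vec_eq_iff forall_2 aff_vec_def aff_coord_def)

lemma aff_vec_pivot [simp]: "aff_vec i j k u $ i = 1"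
  by (simp add: aff_vec_def)

lemma aff_vec_nonzero [simp]: "aff_vec i j k u \<noteq> 0"
  by (metis aff_vec_pivot zero_index zero_neq_one)

lemma Cinf_on_aff_vec:
  assumes "Cinf_on S u"
  shows "Cinf_on S (\<lambda>x. aff_vec i j k (u x))"
proof (rule Cinf_on_vec)
  fix l
  show "Cinf_on S (\<lambda>x. aff_vec i j k (u x) $ l)"
    using Cinf_on_const[OF Cinf_on_open[OF assms]] assms Cinf_on_vec_nth
    by (cases "l = i"; cases "l = j") (auto simp: aff_vec_def)
qed

lemma Cinf_on_aff_coord:
  assumes "Cinf_on S x" "\<And>y. y \<in> S \<Longrightarrow> x y $ i \<noteq> 0"
  shows "Cinf_on S (\<lambda>y. aff_coord i j k (x y))"
proof (rule Cinf_on_vec)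
  fix l :: 2
  show "Cinf_on S (\<lambda>y. aff_coord i j k (x y) $ l)"
    using exhaust_2[of l] Cinf_on_divide[OF Cinf_on_vec_nth[OF assms(1)] Cinf_on_vec_nth[OF assms(1)]]
      assms(2)
    by (auto simp: aff_coord_def)
qed

text \<open>For \<open>X = spike a b v\<close> with \<open>v $ i \<noteq> 0\<close>, the row \<open>i\<close> of \<open>X - a E\<close> is a nonzero multiple
  of \<open>v\<close>.\<close>

definition pivot_row :: "3 \<Rightarrow> real \<Rightarrow> real^3^3 \<Rightarrow> real^3" where
  "pivot_row i a X = (X - a *\<^sub>R mat 1) $ i"

lemma pivot_row_nth: "pivot_row i a X $ j = X $ i $ j - (if i = j then a else 0)"
  by (simp add: pivot_row_def mat_def)

lemma pivot_row_spike: "pivot_row i a (spike a b v) = (b * v $ i) *\<^sub>R v"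
  by (simp add: vec_eq_iff pivot_row_nth)

lemma Cinf_on_pivot_row:
  assumes "Cinf_on S a" "Cinf_on S X"
  shows "Cinf_on S (\<lambda>x. pivot_row i (a x) (X x))"
  unfolding pivot_row_def using assms
  by (intro Cinf_on_vec_nth Cinf_on_diff Cinf_on_scaleR Cinf_on_const Cinf_on_open)

text \<open>Dividing \<open>b\<close> by the squared norm has the same effect as normalizing the
  vector, but it avoids the square root and keeps the parametrization rational in
  \<open>u\<close>.\<close>

definition spike_param :: "3 \<Rightarrow> 3 \<Rightarrow> 3 \<Rightarrow> real \<Rightarrow> real \<Rightarrow> real^2 \<Rightarrow> real^3^3" where
  "spike_param i j k a b u = spike a (b / (aff_vec i j k u \<bullet> aff_vec i j k u)) (aff_vec i j k u)"

lemma spike_scaleR: "spike a b (c *\<^sub>R v) = spike a (c\<^sup>2 * b) v"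
  by (simp add: spike_def outer_scaleR mult.commute)

lemma spike_param_unit:
  fixes u :: "real^2" and i j k :: 3
  defines "w \<equiv> aff_vec i j k u /\<^sub>R norm (aff_vec i j k u)"
  shows "spike_param i j k a b u = spike a b w" "norm w = 1" "w $ i \<noteq> 0"
  by (simp_all add: w_def spike_param_def spike_scaleR power2_norm_eq_inner divide_inverse
      power_inverse mult.commute)

lemma aff_coord_spike_param:
  assumes "{i, j, k} = UNIV" "b \<noteq> 0"
  shows "aff_coord i j k (pivot_row i a (spike_param i j k a b u)) = u"
  unfolding spike_param_def pivot_row_spike
  by (rule aff_coord_aff_vec[OF assms(1)]) (simp add: assms(2))

text \<open>The pivot row is a nonzero multiple of \<open>v\<close>, so its affine vector is
  \<open>v\<close> divided by \<open>v $ i\<close>. This scaling cancels against the squared norm in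
  \<open>spike_param\<close>.\<close>

lemma spike_param_aff_coord:
  assumes "{i, j, k} = UNIV" "b \<noteq> 0" "norm v = 1" "v $ i \<noteq> 0"
  shows "spike_param i j k a b (aff_coord i j k (pivot_row i a (spike a b v))) = spike a b v"
proof -
  have "aff_vec i j k (aff_coord i j k (pivot_row i a (spike a b v))) = v /\<^sub>R v $ i"
    using aff_vec_aff_coord[OF assms(1), of "(b * v $ i) *\<^sub>R v"] assms(2,4)
    by (simp add: pivot_row_spike field_simps)
  moreover have "v \<bullet> v = 1" using assms(3) by (simp add: norm_eq_1)
  ultimately show ?thesis
    using assms(4) by (simp add: spike_param_def spike_scaleR power2_eq_square)
qed

lemma Cinf_on_spike_param:
  assumes "Cinf_on S a" "Cinf_on S b" "Cinf_on S u"
  shows "Cinf_on S (\<lambda>x. spike_param i j k (a x) (b x) (u x))"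
  unfolding spike_param_def using assms
  by (intro Cinf_on_spike Cinf_on_divide Cinf_on_inner Cinf_on_aff_vec) simp_all

section \<open>Eigenvalues as rational functions of the matrix\<close>

definition traceless :: "real^3^3 \<Rightarrow> real^3^3" where
  "traceless X = X - (trace X / 3) *\<^sub>R mat 1"

text \<open>The traceless part of \<open>spike a b v\<close> has the eigenvalues \<open>-b/3, -b/3, 2b/3\<close>; hence the
  traces of its square and of its cube are \<open>2b\<^sup>2/3\<close> and \<open>2b\<^sup>3/9\<close>, and their quotient is \<open>b/3\<close>.\<close>

definition eigen_gap :: "real^3^3 \<Rightarrow> real" where
  "eigen_gap X = 3 * ((traceless X ** traceless X) \<bullet> traceless X) / (traceless X \<bullet> traceless X)"

text \<open>Solves \<open>trace X = 3 * a + b\<close> for \<open>a\<close>, with the gap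
  \<open>b\<close> already known.\<close>

definition double_eigenvalue :: "real^3^3 \<Rightarrow> real" where
  "double_eigenvalue X = (trace X - eigen_gap X) / 3"

lemma traceless_spike:
  fixes v :: "real^3"
  assumes "norm v = 1"
  shows "traceless (spike a b v) = b *\<^sub>R spike (- 1 / 3) 1 v"
  using trace_spike[OF assms, of a b] by (simp add: traceless_def vec_eq_iff mat_def algebra_simps)

text \<open>For a unit vector, \<open>outer v\<close> is an idempotent, so spikes with the same
  \<open>v\<close> multiply like linear polynomials in one projection.\<close>

lemma spike_mult_spike:
  assumes "norm v = 1"
  shows "spike a b v ** spike c d v = spike (a * c) (a * d + b * c + b * d) v"
proof -
  have "(outer v ** outer v) $ i $ j = (v \<bullet> v) * (v $ i * v $ j)" for i j
    by (simp add: matrix_matrix_mult_def inner_vec_def sum_distrib_left sum_distrib_right mult_ac)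
  then have "outer v ** outer v = outer v"
    using assms by (simp add: vec_eq_iff norm_eq_1)
  then show ?thesis
    by (simp add: spike_def matrix_add_ldistrib matrix_add_rdistrib matrix_scalar_ac algebra_simps
        flip: scalar_matrix_assoc)
qed

lemma inner_spike_spike:
  fixes v :: "real^'n" and a b c d :: real
  assumes "norm v = 1"
  shows "spike a b v \<bullet> spike c d v = real CARD('n) * a * c + a * d + b * c + b * d"
proof -
  have v: "v \<bullet> v = 1" using assms by (simp add: norm_eq_1)
  have 1: "outer v \<bullet> outer v = (v \<bullet> v) * (v \<bullet> v)"
    by (simp add: inner_vec_def sum_product mult_ac)
  have 2: "outer v \<bullet> mat 1 = v \<bullet> v" "mat 1 \<bullet> outer v = v \<bullet> v"
    by (simp_all add: inner_vec_def mat_def if_distrib[of "\<lambda>x. x * y" for y]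
        if_distrib[of "\<lambda>x. y * x" for y] cong: if_cong)
  have 3: "(mat 1 :: real^'n^'n) \<bullet> mat 1 = real CARD('n)"
    by (simp add: inner_vec_def mat_def if_distrib[of "\<lambda>x. y * x" for y] cong: if_cong)
  show ?thesis
    by (simp add: spike_def inner_add_left inner_add_right 1 2 3 v algebra_simps)
qed

lemma spike_moments:
  fixes v :: "real^3"
  assumes "norm v = 1"
  defines "Y \<equiv> spike (- 1 / 3) 1 v"
  shows "Y \<bullet> Y = 2 / 3" "(Y ** Y) \<bullet> Y = 2 / 9"
  by (simp_all add: Y_def spike_mult_spike[OF assms(1)] inner_spike_spike[OF assms(1)])

lemma traceless_spike_moments:
  fixes v :: "real^3" and a b :: real
  assumes "norm v = 1"
  defines "Y \<equiv> traceless (spike a b v)"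
  shows "Y \<bullet> Y = 2 / 3 * b\<^sup>2" "(Y ** Y) \<bullet> Y = 2 / 9 * b ^ 3"
  unfolding Y_def traceless_spike[OF assms(1)]
  using spike_moments[OF assms(1)]
  by (simp_all add: power2_eq_square power3_eq_cube matrix_scalar_ac flip: scalar_matrix_assoc)

text \<open>The quotient of the two moments also gives the right value for \<open>b = 0\<close>:
  both of them vanish, and division by zero yields zero.\<close>

lemma eigen_gap_spike:
  fixes v :: "real^3"
  assumes "norm v = 1"
  shows "eigen_gap (spike a b v) = b"
  unfolding eigen_gap_def traceless_spike_moments[OF assms]
  by (simp add: power2_eq_square power3_eq_cube)

lemma double_eigenvalue_spike:
  fixes v :: "real^3"
  assumes "norm v = 1"
  shows "double_eigenvalue (spike a b v) = a"
  by (simp add: double_eigenvalue_def eigen_gap_spike[OF assms] trace_spike[OF assms])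

text \<open>Stated as nonvanishing of the denominator of \<open>eigen_gap\<close>, which makes
  openness of the set and smoothness of the eigenvalue functions on it immediate.\<close>

definition nonscalar :: "(real^3^3) set" where
  "nonscalar = {X. traceless X \<bullet> traceless X \<noteq> 0}"

lemma nonscalar_eq: "nonscalar = - scalar_matrices"
proof -
  have "traceless X = 0 \<longleftrightarrow> X \<in> scalar_matrices" for X :: "real^3^3"
  proof
    assume "X \<in> scalar_matrices"
    then obtain c where "X = c *\<^sub>R mat 1" by (auto simp: scalar_matrices_def)
    then show "traceless X = 0" by (simp add: traceless_def trace_scaleR trace_mat_1)
  qed (auto simp: traceless_def scalar_matrices_def)
  then show ?thesis by (auto simp: nonscalar_def)
qed

lemma spike_nonscalar:
  fixes v :: "real^3"
  assumes "norm v = 1"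
  shows "spike a b v \<in> nonscalar \<longleftrightarrow> b \<noteq> 0"
  unfolding nonscalar_def mem_Collect_eq traceless_spike_moments(1)[OF assms] by simp

lemma Cinf_on_trace: "Cinf_on S f \<Longrightarrow> Cinf_on S (\<lambda>x. trace (f x :: real^'n^'n))"
  unfolding trace_def by (intro Cinf_on_sum Cinf_on_vec_nth Cinf_on_open)

lemma Cinf_on_traceless: "open S \<Longrightarrow> Cinf_on S traceless"
  unfolding traceless_def
  by (intro Cinf_on_diff Cinf_on_scaleR Cinf_on_divide Cinf_on_trace Cinf_on_id Cinf_on_const) simp_all

lemma open_nonscalar: "open nonscalar"
  using Cinf_on_open_neq_0[OF Cinf_on_inner[OF Cinf_on_traceless Cinf_on_traceless], of UNIV]
  by (simp add: nonscalar_def)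

lemma Cinf_on_eigen_gap: "Cinf_on nonscalar eigen_gap"
  unfolding eigen_gap_def
  by (intro Cinf_on_divide Cinf_on_mult Cinf_on_const Cinf_on_inner Cinf_on_matrix_mult
      Cinf_on_traceless open_nonscalar) (simp add: nonscalar_def)

lemma Cinf_on_double_eigenvalue: "Cinf_on nonscalar double_eigenvalue"
  unfolding double_eigenvalue_def
  by (intro Cinf_on_divide Cinf_on_diff Cinf_on_trace Cinf_on_eigen_gap Cinf_on_id Cinf_on_const
      open_nonscalar) simp

section \<open>Charts of \<M> and of its traceless part\<close>

definition chart_dom :: "3 \<Rightarrow> (real^3^3) set" where
  "chart_dom i = {X \<in> nonscalar. pivot_row i (double_eigenvalue X) X $ i \<noteq> 0}"

definition chart_coord :: "3 \<Rightarrow> 3 \<Rightarrow> 3 \<Rightarrow> real^3^3 \<Rightarrow> real^2" where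
  "chart_coord i j k X = aff_coord i j k (pivot_row i (double_eigenvalue X) X)"

lemma open_chart_dom: "open (chart_dom i)"
  unfolding chart_dom_def
  by (intro Cinf_on_open_neq_0 Cinf_on_vec_nth Cinf_on_pivot_row Cinf_on_double_eigenvalue Cinf_on_id
      open_nonscalar)

lemma Cinf_on_chart_dom:
  shows "Cinf_on (chart_dom i) double_eigenvalue" "Cinf_on (chart_dom i) eigen_gap"
    and "Cinf_on (chart_dom i) (chart_coord i j k)"
proof -
  have sub: "chart_dom i \<subseteq> nonscalar" by (auto simp: chart_dom_def)
  show de: "Cinf_on (chart_dom i) double_eigenvalue" "Cinf_on (chart_dom i) eigen_gap"
    using Cinf_on_subset[OF _ open_chart_dom sub] Cinf_on_double_eigenvalue Cinf_on_eigen_gap by auto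
  show "Cinf_on (chart_dom i) (chart_coord i j k)"
    unfolding chart_coord_def
    by (intro Cinf_on_aff_coord Cinf_on_pivot_row de(1) Cinf_on_id open_chart_dom)
      (simp add: chart_dom_def)
qed

text \<open>The diagonal entry tested by \<open>chart_dom\<close> equals \<open>b\<close> times the
  square of \<open>v $ i\<close>.\<close>

lemma spike_in_chart_dom:
  assumes "norm v = 1"
  shows "spike a b v \<in> chart_dom i \<longleftrightarrow> b \<noteq> 0 \<and> v $ i \<noteq> 0"
  by (auto simp: chart_dom_def double_eigenvalue_spike[OF assms] pivot_row_spike
      spike_nonscalar[OF assms])

lemma spike_param_facts:
  assumes "b \<noteq> 0"
  shows "spike_param i j k a b u \<in> \<M>" "spike_param i j k a b u \<in> chart_dom i"
    "spike_param i j k a b u \<in> nonscalar"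
    "double_eigenvalue (spike_param i j k a b u) = a" "eigen_gap (spike_param i j k a b u) = b"
    "trace (spike_param i j k a b u) = 3 * a + b"
  using spike_param_unit[where i=i and j=j and k=k and u=u] assms
  by (simp_all add: spike_in_\<M> spike_in_chart_dom spike_nonscalar double_eigenvalue_spike
      eigen_gap_spike trace_spike)

lemma chart_coord_spike_param:
  assumes "{i, j, k} = UNIV" "b \<noteq> 0"
  shows "chart_coord i j k (spike_param i j k a b u) = u"
  by (simp add: chart_coord_def spike_param_facts assms aff_coord_spike_param)

lemma spike_param_chart_coord:
  assumes "{i, j, k} = UNIV" "X \<in> \<M>" "X \<in> chart_dom i"
  shows "spike_param i j k (double_eigenvalue X) (eigen_gap X) (chart_coord i j k X) = X"
    and "eigen_gap X \<noteq> 0"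
proof -
  obtain a b v where v: "norm v = 1" "X = spike a b v" using \<M>_imp_spike[OF assms(2)] by blast
  with assms(3) have "b \<noteq> 0" "v $ i \<noteq> 0" by (simp_all add: spike_in_chart_dom)
  then show "spike_param i j k (double_eigenvalue X) (eigen_gap X) (chart_coord i j k X) = X"
    "eigen_gap X \<noteq> 0"
    using v spike_param_aff_coord[OF assms(1), of b v a]
    by (simp_all add: chart_coord_def double_eigenvalue_spike eigen_gap_spike)
qed

lemma \<M>_covered_by_chart_dom:
  assumes "X \<in> \<M> \<inter> nonscalar"
  obtains i where "X \<in> chart_dom i"
proof -
  obtain a b v where v: "norm v = 1" "X = spike a b v" using \<M>_imp_spike assms by blast
  with assms have "b \<noteq> 0" by (simp add: spike_nonscalar)
  moreover obtain i where "v $ i \<noteq> 0" using unit_vec_nth_nonzero[OF v(1)] by blast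
  ultimately show ?thesis using that v by (simp add: spike_in_chart_dom)
qed

lemma trace_eigen: "trace X = 3 * double_eigenvalue X + eigen_gap X"
  by (simp add: double_eigenvalue_def field_simps)

text \<open>Two eigenvalue parameters and two affine coordinates of the line of \<open>v\<close>
  make four coordinates.\<close>

lemma chart_\<M>:
  assumes t: "{i, j, k} = UNIV"
  shows "chart_with_inverse (\<M> \<inter> nonscalar) (chart_dom i)
     (\<lambda>X. (double_eigenvalue X, eigen_gap X, chart_coord i j k X))
     {y :: real \<times> real \<times> (real^2). fst (snd y) \<noteq> 0}
     (\<lambda>y. spike_param i j k (fst y) (fst (snd y)) (snd (snd y)))"
proof (rule chart_with_inverseI)
  have "open {y :: real \<times> real \<times> (real^2). fst (snd y) \<noteq> 0}"
    using Cinf_on_open_neq_0[OF Cinf_on_fst[OF Cinf_on_snd[OF Cinf_on_id[OF open_UNIV]]]] by simp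
  then show "Cinf_on {y :: real \<times> real \<times> (real^2). fst (snd y) \<noteq> 0}
      (\<lambda>y. spike_param i j k (fst y) (fst (snd y)) (snd (snd y)))"
    by (intro Cinf_on_spike_param Cinf_on_fst Cinf_on_snd Cinf_on_id)
qed (use spike_param_chart_coord[OF t] in
    \<open>auto intro!: Cinf_on_Pair Cinf_on_chart_dom simp: spike_param_facts chart_coord_spike_param[OF t]\<close>)

text \<open>Vanishing trace forces \<open>a = - b / 3\<close>, so the coordinate for the double
  eigenvalue is dropped and three remain.\<close>

lemma chart_\<M>\<^sub>0:
  assumes t: "{i, j, k} = UNIV"
  shows "chart_with_inverse (\<M>\<^sub>0 \<inter> nonscalar) (chart_dom i)
     (\<lambda>X. (eigen_gap X, chart_coord i j k X)) {y :: real \<times> (real^2). fst y \<noteq> 0}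
     (\<lambda>y. spike_param i j k (- fst y / 3) (fst y) (snd y))"
proof (rule chart_with_inverseI)
  have o: "open {y :: real \<times> (real^2). fst y \<noteq> 0}"
    using Cinf_on_open_neq_0[OF Cinf_on_fst[OF Cinf_on_id[OF open_UNIV]]] by simp
  have "Cinf_on {y :: real \<times> (real^2). fst y \<noteq> 0} (\<lambda>y. (0 - fst y) / 3)"
    using o by (intro Cinf_on_divide Cinf_on_diff Cinf_on_fst Cinf_on_id Cinf_on_const) simp_all
  then show "Cinf_on {y :: real \<times> (real^2). fst y \<noteq> 0}
      (\<lambda>y. spike_param i j k (- fst y / 3) (fst y) (snd y))"
    using o by (intro Cinf_on_spike_param Cinf_on_fst Cinf_on_snd Cinf_on_id) simp_all
  show "spike_param i j k (- fst (eigen_gap X, chart_coord i j k X) / 3)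
      (fst (eigen_gap X, chart_coord i j k X)) (snd (eigen_gap X, chart_coord i j k X)) = X"
    if "X \<in> \<M>\<^sub>0 \<inter> nonscalar" "X \<in> chart_dom i" for X
  proof -
    have "- eigen_gap X / 3 = double_eigenvalue X"
      using trace_eigen[of X] that(1) unfolding \<M>\<^sub>0_def by auto
    then show ?thesis
      using spike_param_chart_coord(1)[OF t, of X] that by (simp add: \<M>\<^sub>0_def)
  qed
qed (use spike_param_chart_coord[OF t] in
    \<open>auto intro!: Cinf_on_Pair Cinf_on_chart_dom simp: spike_param_facts chart_coord_spike_param[OF t] \<M>\<^sub>0_def\<close>)

lemma smooth_submanifold_\<M>: "smooth_submanifold 4 (\<M> \<inter> nonscalar)"
proof -
  have "smooth_submanifold DIM(real \<times> real \<times> (real^2)) (\<M> \<inter> nonscalar)"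
  proof (rule smooth_submanifoldI)
    fix X assume X: "X \<in> \<M> \<inter> nonscalar"
    then obtain i where i: "X \<in> chart_dom i" by (rule \<M>_covered_by_chart_dom)
    obtain j k where "{i, j, k} = UNIV" using ex_triple[of i] by blast
    from i chart_\<M>[OF this]
    show "\<exists>W (\<phi> :: _ \<Rightarrow> real \<times> real \<times> (real^2)) V \<psi>.
        X \<in> W \<and> chart_with_inverse (\<M> \<inter> nonscalar) W \<phi> V \<psi>" by blast
  qed simp
  then show ?thesis by (simp add: eval_nat_numeral)
qed

lemma smooth_submanifold_\<M>\<^sub>0: "smooth_submanifold 3 (\<M>\<^sub>0 \<inter> nonscalar)"
proof -
  have "smooth_submanifold DIM(real \<times> (real^2)) (\<M>\<^sub>0 \<inter> nonscalar)"
  proof (rule smooth_submanifoldI)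
    fix X assume "X \<in> \<M>\<^sub>0 \<inter> nonscalar"
    then have "X \<in> \<M> \<inter> nonscalar" by (simp add: \<M>\<^sub>0_def)
    then obtain i where i: "X \<in> chart_dom i" by (rule \<M>_covered_by_chart_dom)
    obtain j k where "{i, j, k} = UNIV" using ex_triple[of i] by blast
    from i chart_\<M>\<^sub>0[OF this]
    show "\<exists>W (\<phi> :: _ \<Rightarrow> real \<times> (real^2)) V \<psi>.
        X \<in> W \<and> chart_with_inverse (\<M>\<^sub>0 \<inter> nonscalar) W \<phi> V \<psi>" by blast
  qed simp
  then show ?thesis by (simp add: eval_nat_numeral)
qed

section \<open>Singular points\<close>

text \<open>The chain rule along the line through \<open>x\<close> in direction \<open>v\<close>.
  Limits of difference quotients are the form of the derivative that can be combined with closedness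
  of a set.\<close>

lemma has_derivative_directional_limit:
  fixes f :: "'a::real_normed_vector \<Rightarrow> 'b::real_normed_vector"
  assumes "(f has_derivative f') (at x)"
  shows "((\<lambda>t. (f (x + t *\<^sub>R v) - f x) /\<^sub>R t) \<longlongrightarrow> f' v) (at 0)"
proof -
  have "((\<lambda>t. x + t *\<^sub>R v) has_derivative (\<lambda>t. t *\<^sub>R v)) (at 0)"
    by (auto intro!: derivative_eq_intros)
  from has_derivative_compose[OF this, of f f'] assms
  have "((\<lambda>t. f (x + t *\<^sub>R v)) has_derivative (\<lambda>t. f' (t *\<^sub>R v))) (at 0)" by simp
  then have "((\<lambda>t. norm (f (x + t *\<^sub>R v) - f x - f' (t *\<^sub>R v)) / norm t) \<longlongrightarrow> 0) (at 0)"
    by (simp add: has_derivative_iff_norm)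
  moreover have "\<forall>\<^sub>F t in at 0. norm (f (x + t *\<^sub>R v) - f x - f' (t *\<^sub>R v)) / norm t =
      norm ((f (x + t *\<^sub>R v) - f x) /\<^sub>R t - f' v)"
  proof (rule eventually_mono[OF eventually_neq_at_within[of 0]])
    fix t :: real assume t: "t \<noteq> 0"
    have "f' (t *\<^sub>R v) = t *\<^sub>R f' v"
      using assms has_derivative_linear linear_cmul by blast
    then have "(f (x + t *\<^sub>R v) - f x - f' (t *\<^sub>R v)) /\<^sub>R t = (f (x + t *\<^sub>R v) - f x) /\<^sub>R t - f' v"
      using t by (simp add: scaleR_diff_right)
    then have "norm ((f (x + t *\<^sub>R v) - f x) /\<^sub>R t - f' v) =
        norm ((f (x + t *\<^sub>R v) - f x - f' (t *\<^sub>R v)) /\<^sub>R t)" by simp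
    then show "norm (f (x + t *\<^sub>R v) - f x - f' (t *\<^sub>R v)) / norm t =
        norm ((f (x + t *\<^sub>R v) - f x) /\<^sub>R t - f' v)"
      by (simp add: divide_inverse mult.commute)
  qed
  ultimately have "((\<lambda>t. norm ((f (x + t *\<^sub>R v) - f x) /\<^sub>R t - f' v)) \<longlongrightarrow> 0) (at 0)"
    by (rule Lim_transform_eventually)
  then show ?thesis by (simp add: tendsto_norm_zero_iff LIM_zero_iff)
qed

lemma eventually_line_in_open:
  fixes p :: "'a::real_normed_vector"
  assumes "open W" "p \<in> W"
  shows "\<forall>\<^sub>F t in at 0. p + t *\<^sub>R v \<in> W"
proof -
  have "((\<lambda>t. p + t *\<^sub>R v) \<longlongrightarrow> p + 0 *\<^sub>R v) (at 0)"
    by (intro tendsto_intros)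
  then show ?thesis using assms by (auto dest: topological_tendstoD)
qed

text \<open>Near a regular point, \<open>M\<close> is parametrised by a subspace \<open>L\<close>.  Directions of lines contained
  in \<open>M\<close> are tangent directions, and these form a vector space.\<close>

lemma sum_of_lines_is_tangent:
  fixes M :: "'a::euclidean_space set"
  assumes reg: "regular_point M p"
    and line1: "\<And>t. p + t *\<^sub>R X1 \<in> M" and line2: "\<And>t. p + t *\<^sub>R X2 \<in> M"
  obtains \<gamma> where "((\<lambda>t. (\<gamma> t - p) /\<^sub>R t) \<longlongrightarrow> X1 + X2) (at 0)" "\<forall>\<^sub>F t in at 0. \<gamma> t \<in> M"
proof -
  obtain d U where "p \<in> U" "openin (top_of_set M) U" "smooth_submanifold d U"
    using reg by (auto simp: regular_point_def regular_point_dim_def)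
  then obtain U' L and \<phi> :: "'a \<Rightarrow> 'a" where p: "p \<in> U'" and "openin (top_of_set U) U'"
    and L: "subspace L" and \<phi>_open: "openin (top_of_set L) (\<phi> ` U')"
    and \<phi>: "diffeo_betw \<phi> U' (\<phi> ` U')"
    unfolding smooth_submanifold_def by metis
  then have "openin (top_of_set M) U'"
    using \<open>openin (top_of_set M) U\<close> by (metis openin_trans)
  then obtain O1 where O1: "open O1" "U' = M \<inter> O1" by (auto simp: openin_open)
  obtain O2 where O2: "open O2" "\<phi> ` U' = L \<inter> O2" using \<phi>_open by (auto simp: openin_open)
  have inj: "inj_on \<phi> U'" and \<phi>_smooth: "smooth_on U' \<phi>" "smooth_on (\<phi> ` U') (inv_into U' \<phi>)"
    using \<phi> by (simp_all add: diffeo_betw_def bij_betw_def)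
  obtain W h where h: "p \<in> W" "Cinf_on W h" "\<forall>y\<in>W \<inter> U'. h y = \<phi> y"
    using \<phi>_smooth(1) p unfolding smooth_on_alt by blast
  obtain V g where g: "\<phi> p \<in> V" "Cinf_on V g" "\<forall>y\<in>V \<inter> \<phi> ` U'. g y = inv_into U' \<phi> y"
    using \<phi>_smooth(2) p unfolding smooth_on_alt by blast
  have hp: "h p = \<phi> p" using h(1,3) p by blast
  have gp: "g (\<phi> p) = p" using g(1,3) p inj by (simp add: inv_into_f_f)
  obtain h' where h': "(h has_derivative h') (at p)"
    using Cinf_on_differentiable[OF h(2,1)] by (auto simp: differentiable_def)
  obtain g' where g': "(g has_derivative g') (at (\<phi> p))"
    using Cinf_on_differentiable[OF g(2,1)] by (auto simp: differentiable_def)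
  \<comment> \<open>Here \<open>h\<close> extends the chart and \<open>g\<close> its inverse. Along
    a line in \<open>M\<close> the difference quotients of \<open>h\<close> stay in the closed
    subspace \<open>L\<close>, and \<open>g\<close> after \<open>h\<close> is the identity, so
    differentiation gives both claims.\<close>
  have tangent: "h' X \<in> L \<and> g' (h' X) = X" if line: "\<And>t. p + t *\<^sub>R X \<in> M" for X
  proof -
    have "open (W \<inter> h -` V)"
      by (rule continuous_open_preimage[OF Cinf_on_continuous[OF h(2)] Cinf_on_open[OF h(2)]
            Cinf_on_open[OF g(2)]])
    moreover have "p \<in> W \<inter> h -` V \<inter> O1" using h(1) g(1) hp p O1(2) by auto
    ultimately have ev: "\<forall>\<^sub>F t in at 0. p + t *\<^sub>R X \<in> W \<inter> h -` V \<inter> O1"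
      by (intro eventually_line_in_open) (auto intro!: open_Int O1(1))
    have in_L: "(h (p + t *\<^sub>R X) - h p) /\<^sub>R t \<in> L" and gh: "g (h (p + t *\<^sub>R X)) = p + t *\<^sub>R X"
      if t: "p + t *\<^sub>R X \<in> W \<inter> h -` V \<inter> O1" for t
    proof -
      have U': "p + t *\<^sub>R X \<in> U'" using t line O1(2) by simp
      then have eq: "h (p + t *\<^sub>R X) = \<phi> (p + t *\<^sub>R X)" using h(3) t by simp
      have "\<phi> (p + t *\<^sub>R X) \<in> L" "\<phi> p \<in> L" using O2(2) U' p by auto
      then show "(h (p + t *\<^sub>R X) - h p) /\<^sub>R t \<in> L"
        using L eq hp by (simp add: subspace_diff subspace_scale)
      have "\<phi> (p + t *\<^sub>R X) \<in> V \<inter> \<phi> ` U'" using t eq U' by auto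
      then show "g (h (p + t *\<^sub>R X)) = p + t *\<^sub>R X"
        using g(3) eq inv_into_f_f[OF inj U'] by simp
    qed
    have "h' X \<in> L"
      by (rule Lim_in_closed_set[OF closed_subspace[OF L] _ _ has_derivative_directional_limit[OF h']])
        (use eventually_mono[OF ev in_L] in simp_all)
    moreover have "g' (h' X) = X"
    proof (rule tendsto_unique)
      have "((\<lambda>x. g (h x)) has_derivative (\<lambda>x. g' (h' x))) (at p)"
        using has_derivative_compose[OF h', of g g'] g' hp by simp
      from has_derivative_directional_limit[OF this]
      show "((\<lambda>t. (g (h (p + t *\<^sub>R X)) - g (h p)) /\<^sub>R t) \<longlongrightarrow> g' (h' X)) (at 0)" .
      have "\<forall>\<^sub>F t in at 0. X = (g (h (p + t *\<^sub>R X)) - g (h p)) /\<^sub>R t"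
        using ev eventually_neq_at_within[of 0]
        by eventually_elim (simp add: gh hp gp)
      from Lim_transform_eventually[OF tendsto_const this]
      show "((\<lambda>t. (g (h (p + t *\<^sub>R X)) - g (h p)) /\<^sub>R t) \<longlongrightarrow> X) (at 0)" .
    qed simp
    ultimately show ?thesis ..
  qed
  \<comment> \<open>The sum of the two images stays in \<open>L\<close>, so a short segment from
    \<open>\<phi> p\<close> in this direction lies in the chart image; \<open>g\<close> carries it
    to the required curve in \<open>M\<close>.\<close>
  let ?Y = "h' X1 + h' X2"
  have Y: "?Y \<in> L" using tangent[OF line1] tangent[OF line2] L by (simp add: subspace_add)
  have "g' ?Y = X1 + X2"
    using tangent[OF line1] tangent[OF line2] linear_add[OF has_derivative_linear[OF g']] by simp
  with has_derivative_directional_limit[OF g', of ?Y] gp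
  have lim: "((\<lambda>t. (g (\<phi> p + t *\<^sub>R ?Y) - p) /\<^sub>R t) \<longlongrightarrow> X1 + X2) (at 0)" by simp
  have "\<phi> p \<in> V \<inter> O2" "\<phi> p \<in> L" using g(1) O2(2) p by auto
  then have "\<forall>\<^sub>F t in at 0. \<phi> p + t *\<^sub>R ?Y \<in> V \<inter> O2"
    using Cinf_on_open[OF g(2)] O2(1) by (intro eventually_line_in_open open_Int)
  then have "\<forall>\<^sub>F t in at 0. g (\<phi> p + t *\<^sub>R ?Y) \<in> M"
  proof eventually_elim
    fix t assume t: "\<phi> p + t *\<^sub>R ?Y \<in> V \<inter> O2"
    have "\<phi> p + t *\<^sub>R ?Y \<in> L"
      by (rule subspace_add[OF L \<open>\<phi> p \<in> L\<close> subspace_scale[OF L Y]])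
    with t O2(2) have "\<phi> p + t *\<^sub>R ?Y \<in> V \<inter> \<phi> ` U'" by simp
    then have "g (\<phi> p + t *\<^sub>R ?Y) \<in> U'" using g(3) by (auto simp: inv_into_into)
    then show "g (\<phi> p + t *\<^sub>R ?Y) \<in> M" using O1(2) by simp
  qed
  with lim show ?thesis by (rule that)
qed

text \<open>For symmetric \<open>X\<close>, this is twice the discriminant of the characteristic polynomial.\<close>

definition disc :: "real^3^3 \<Rightarrow> real" where
  "disc X = (traceless X \<bullet> traceless X) ^ 3 - 6 * ((traceless X ** traceless X) \<bullet> traceless X)\<^sup>2"

text \<open>By the moments of a spike, both terms of \<open>disc\<close> equal
  \<open>8 * b ^ 6 / 27\<close>.\<close>

lemma disc_\<M>: "X \<in> \<M> \<Longrightarrow> disc X = 0"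
  by (erule \<M>_imp_spike)
    (simp add: disc_def traceless_spike_moments field_simps eval_nat_numeral)

lemma isCont_disc: "isCont disc X"
proof -
  have "Cinf_on UNIV disc"
    unfolding disc_def power2_eq_square power3_eq_cube
    by (intro Cinf_on_diff Cinf_on_mult Cinf_on_inner Cinf_on_matrix_mult Cinf_on_traceless
        Cinf_on_const) simp_all
  then show ?thesis
    using Cinf_on_continuous continuous_on_eq_continuous_at open_UNIV by blast
qed

lemma scalar_not_regular: "\<not> regular_point \<M> (c *\<^sub>R mat 1)"
proof
  let ?e2 = "axis 2 1 :: real^3" and ?e3 = "axis 3 1 :: real^3"
  have line: "c *\<^sub>R mat 1 + t *\<^sub>R s *\<^sub>R outer v \<in> \<M>" if "norm v = 1" for t s and v :: "real^3"
    using spike_in_\<M>[OF that, of c "t * s"] by (simp add: spike_def)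
  have lines: "\<And>t. c *\<^sub>R mat 1 + t *\<^sub>R 1 *\<^sub>R outer ?e2 \<in> \<M>"
    "\<And>t. c *\<^sub>R mat 1 + t *\<^sub>R (- 1) *\<^sub>R outer ?e3 \<in> \<M>"
    by (rule line[OF norm_axis_1])+
  assume reg: "regular_point \<M> (c *\<^sub>R mat 1)"
  obtain \<gamma> where lim: "((\<lambda>t. (\<gamma> t - c *\<^sub>R mat 1) /\<^sub>R t) \<longlongrightarrow>
        1 *\<^sub>R outer ?e2 + (- 1) *\<^sub>R outer ?e3) (at 0)"
    and in_M: "\<forall>\<^sub>F t in at 0. \<gamma> t \<in> \<M>"
    by (rule sum_of_lines_is_tangent[OF reg lines])
  let ?Z = "1 *\<^sub>R outer ?e2 + (- 1) *\<^sub>R outer ?e3"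
  have "((\<lambda>t. disc ((\<gamma> t - c *\<^sub>R mat 1) /\<^sub>R t)) \<longlongrightarrow> disc ?Z) (at 0)"
    by (rule isCont_tendsto_compose[OF isCont_disc lim])
  moreover have "\<forall>\<^sub>F t in at 0. disc ((\<gamma> t - c *\<^sub>R mat 1) /\<^sub>R t) = 0"
    using in_M
  proof eventually_elim
    fix t assume "\<gamma> t \<in> \<M>"
    then obtain a b v where v: "norm v = 1" "\<gamma> t = spike a b v" by (rule \<M>_imp_spike)
    \<comment> \<open>Invariance under homotheties centred at \<open>c E\<close>. At
      \<open>t = 0\<close> both sides are the zero matrix, by the convention for division by
      zero.\<close>
    then have "(\<gamma> t - c *\<^sub>R mat 1) /\<^sub>R t = spike ((a - c) / t) (b / t) v"
      by (simp add: vec_eq_iff mat_def divide_inverse algebra_simps)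
    then show "disc ((\<gamma> t - c *\<^sub>R mat 1) /\<^sub>R t) = 0"
      using spike_in_\<M>[OF v(1)] by (simp add: disc_\<M>)
  qed
  ultimately have "((\<lambda>t :: real. 0 :: real) \<longlongrightarrow> disc ?Z) (at 0)"
    by (rule Lim_transform_eventually)
  then have "disc ?Z = 0" by (simp add: tendsto_const_iff)
  \<comment> \<open>The limit direction is \<open>diag(0, 1, -1)\<close>. It is traceless, has
    squared norm 2, and its cube has trace zero, so its \<open>disc\<close> is 8.\<close>
  moreover have "traceless ?Z = ?Z"
    by (simp add: traceless_def trace_def sum_3 axis_def)
  moreover have "?Z \<bullet> ?Z = 2"
    by (simp add: inner_vec_def sum_3 axis_def)
  moreover have "(?Z ** ?Z) \<bullet> ?Z = 0"
    by (simp add: inner_vec_def matrix_matrix_mult_def sum_3 axis_def)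
  ultimately show False by (simp add: disc_def)
qed

lemma scalar_in_\<M>: "scalar_matrices \<subseteq> \<M>"
proof
  fix X :: "real^3^3" assume "X \<in> scalar_matrices"
  then obtain c where "X = c *\<^sub>R mat 1" by (auto simp: scalar_matrices_def)
  then show "X \<in> \<M>" using spike_in_\<M>[of "axis 1 1" c 0] by (simp add: spike_def)
qed

lemma regular_point_dim_\<M>:
  assumes "X \<in> \<M>" "X \<notin> scalar_matrices"
  shows "regular_point_dim 4 \<M> X"
  unfolding regular_point_dim_def
  using smooth_submanifold_\<M> assms openin_open_Int[OF open_nonscalar, of \<M>]
  by (intro exI[of _ "\<M> \<inter> nonscalar"]) (simp add: nonscalar_eq)

lemma regular_point_dim_\<M>\<^sub>0:
  assumes "X \<in> \<M>\<^sub>0" "X \<in> nonscalar"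
  shows "regular_point_dim 3 \<M>\<^sub>0 X"
  unfolding regular_point_dim_def
  using smooth_submanifold_\<M>\<^sub>0 assms openin_open_Int[OF open_nonscalar, of \<M>\<^sub>0]
  by (intro exI[of _ "\<M>\<^sub>0 \<inter> nonscalar"]) simp

lemma singular_points_\<M>: "singular_points \<M> = scalar_matrices"
  using regular_point_dim_\<M> scalar_in_\<M> scalar_not_regular
  by (fastforce simp: singular_points_def regular_point_def scalar_matrices_def)

section \<open>The traceless part\<close>

lemma spike_in_\<M>\<^sub>0:
  assumes "norm v = 1"
  shows "spike a b v \<in> \<M>\<^sub>0 \<longleftrightarrow> a = - b / 3"
  using trace_spike[OF assms, of a b] spike_in_\<M>[OF assms, of a b] by (auto simp: \<M>\<^sub>0_def)

lemma \<M>\<^sub>0_imp_spike: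
  assumes "X \<in> \<M>\<^sub>0"
  obtains b v where "norm v = 1" "X = spike (- b / 3) b v"
proof -
  have "X \<in> \<M>" using assms by (simp add: \<M>\<^sub>0_def)
  then obtain a b v where "norm v = 1" "X = spike a b v" by (rule \<M>_imp_spike)
  then show ?thesis using that assms spike_in_\<M>\<^sub>0 by metis
qed

lemma straight_cylinder_\<M>: "straight_cylinder_over \<M>\<^sub>0 (mat 1) \<M>"
proof -
  have "mat 1 \<bullet> X = trace X" for X :: "real^3^3"
    by (simp add: inner_vec_def sum_3 mat_def trace_def)
  then have "\<M>\<^sub>0 \<subseteq> {X. mat 1 \<bullet> X = 0}" by (auto simp: \<M>\<^sub>0_def)
  moreover have "(mat 1 :: real^3^3) \<noteq> 0" by (simp add: vec_eq_iff mat_def)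
  moreover have "\<M> = {X + c *\<^sub>R mat 1 | X c. X \<in> \<M>\<^sub>0}"
  proof (intro Set.equalityI subsetI)
    fix A assume "A \<in> \<M>"
    then obtain a b v where v: "norm v = 1" "A = spike a b v" by (rule \<M>_imp_spike)
    \<comment> \<open>The shift \<open>a + b / 3\<close> is one third of the trace of
      \<open>A\<close>.\<close>
    have "A = spike (- b / 3) b v + (a + b / 3) *\<^sub>R mat 1" "spike (- b / 3) b v \<in> \<M>\<^sub>0"
      by (simp_all add: v vec_eq_iff mat_def spike_in_\<M>\<^sub>0)
    then show "A \<in> {X + c *\<^sub>R mat 1 | X c. X \<in> \<M>\<^sub>0}" by blast
  next
    fix A assume "A \<in> {X + c *\<^sub>R mat 1 | X c. X \<in> \<M>\<^sub>0}"
    then obtain X c where X: "X \<in> \<M>\<^sub>0" "A = X + c *\<^sub>R mat 1" by blast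
    from X(1) obtain b v where v: "norm v = 1" "X = spike (- b / 3) b v" by (rule \<M>\<^sub>0_imp_spike)
    then have "A = spike (c - b / 3) b v" using X(2) by (simp add: vec_eq_iff mat_def)
    then show "A \<in> \<M>" using v(1) by (simp add: spike_in_\<M>)
  qed
  ultimately show ?thesis unfolding straight_cylinder_over_def by blast
qed

lemma surface_of_dim_\<M>\<^sub>0: "surface_of_dim 3 \<M>\<^sub>0"
proof -
  let ?R = "{X \<in> \<M>\<^sub>0. regular_point_dim 3 \<M>\<^sub>0 X}"
  let ?e = "axis 1 1 :: real^3"
  have R: "spike (- b / 3) b v \<in> ?R" if "b \<noteq> 0" "norm v = 1" for b v
    using that by (simp add: spike_in_\<M>\<^sub>0 spike_nonscalar regular_point_dim_\<M>\<^sub>0)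
  have "X \<in> closure ?R" if X: "X \<in> \<M>\<^sub>0" for X
    unfolding closure_approachable
  proof (intro allI impI)
    fix e :: real assume e: "e > 0"
    obtain b v where v: "norm v = 1" "X = spike (- b / 3) b v" using X by (rule \<M>\<^sub>0_imp_spike)
    \<comment> \<open>The sign moves \<open>b\<close> away from zero, so that the perturbed gap
      \<open>b + s\<close> is nonzero and the new point is regular.\<close>
    define s where "s = (if b \<ge> 0 then e else - e)"
    have "dist (spike (- (b + s) / 3) (b + s) v) X = norm (s *\<^sub>R spike (- 1 / 3) 1 v)"
      unfolding dist_norm v(2) by (rule arg_cong[of _ _ norm]) (simp add: vec_eq_iff field_simps)
    also have "\<dots> = \<bar>s\<bar> * sqrt (2 / 3)"
      unfolding norm_scaleR norm_eq_sqrt_inner[of "spike _ _ _"] spike_moments(1)[OF v(1)] ..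
    also have "\<bar>s\<bar> = e" using e by (simp add: s_def)
    also have "e * sqrt (2 / 3) < e" using e by simp
    finally show "\<exists>Y\<in>?R. dist Y X < e"
      using R[of "b + s" v] v(1) e by (auto simp: s_def split: if_splits)
  qed
  moreover have "\<M>\<^sub>0 \<noteq> {}" using spike_in_\<M>\<^sub>0[of ?e 0 0] by auto
  ultimately show ?thesis unfolding surface_of_dim_def by blast
qed

section \<open>The space of traceless symmetric matrices and spheres containing the orbits\<close>

definition Sym_traceless :: "(real^3^3) set" where
  "Sym_traceless = {X \<in> Sym. trace X = 0}"

lemma Sym_iff: "X \<in> Sym \<longleftrightarrow> (\<forall>i j. X $ i $ j = X $ j $ i)"
  by (auto simp: Sym_def vec_eq_iff transpose_def)

lemma subspace_Sym: "subspace Sym"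
  by (auto simp: subspace_def Sym_iff)

lemma subspace_Sym_traceless: "subspace Sym_traceless"
proof -
  have "trace (0 :: real^3^3) = 0" by (simp add: trace_def)
  then show ?thesis
    using subspace_Sym by (auto simp: subspace_def Sym_traceless_def trace_add trace_scaleR)
qed

lemma dim_Sym_traceless: "dim Sym_traceless = 5"
proof -
  \<comment> \<open>Five entries are free: two on the diagonal and three above it. The last diagonal
    entry is fixed by the trace.\<close>
  define f :: "real \<times> real \<times> real \<times> real \<times> real \<Rightarrow> real^3^3" where
    "f = (\<lambda>(p, q, s, t, u). vector [vector [p, s, t], vector [s, q, u], vector [t, u, - p - q]])"
  have lin: "linear f"
    by (rule linearI) (auto simp: f_def vec_eq_iff forall_3 algebra_simps split: prod.splits)
  have inj: "inj f"
    by (rule injI) (auto simp: f_def vec_eq_iff forall_3 split: prod.splits)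
  have "range f = Sym_traceless"
  proof (intro Set.equalityI subsetI)
    fix X assume X: "X \<in> Sym_traceless"
    then have "X$2$1 = X$1$2" "X$3$1 = X$1$3" "X$3$2 = X$2$3"
      by (auto simp: Sym_traceless_def intro: Sym_nth)
    moreover have "X$3$3 = - X$1$1 - X$2$2"
      using X by (simp add: Sym_traceless_def trace_def sum_3)
    ultimately have "X = f (X$1$1, X$2$2, X$1$2, X$1$3, X$2$3)"
      by (simp add: f_def vec_eq_iff forall_3)
    then show "X \<in> range f" by blast
  qed (auto simp: f_def Sym_traceless_def Sym_iff trace_def sum_3 forall_3)
  then show ?thesis
    using dim_image_eq[OF lin, of UNIV] inj by (simp add: dim_UNIV)
qed

lemma trace_traceless: "trace (traceless X) = 0"
  by (simp add: traceless_def trace_diff trace_scaleR trace_mat_1)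

text \<open>Trace and norm of the traceless part are constant on an orbit. So the center is the
  common scalar part, the radius is that norm, and the sphere lives in a translate of the
  5-dimensional space of traceless symmetric matrices.\<close>

lemma Orbit_spike_on_sphere:
  fixes v :: "real^3"
  assumes v: "norm v = 1" and b: "b \<noteq> 0"
  shows "\<exists>S. sphere_of_dim Sym 4 ((a + b / 3) *\<^sub>R mat 1) S \<and> Orbit (spike a b v) \<subseteq> S"
proof -
  let ?c = "(a + b / 3) *\<^sub>R mat 1 :: real^3^3" and ?r = "sqrt (2 / 3 * b\<^sup>2)"
  let ?V = "(+) ?c ` Sym_traceless"
  have "affine ?V"
    using subspace_imp_affine[OF subspace_Sym_traceless] affine_translation by blast
  moreover have "?V \<subseteq> Sym" by (auto simp: Sym_traceless_def Sym_iff mat_def)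
  moreover have "?c \<in> ?V"
    using subspace_0[OF subspace_Sym_traceless] by force
  moreover have "aff_dim ?V = int 4 + 1"
    by (simp add: aff_dim_translation_eq aff_dim_subspace subspace_Sym_traceless dim_Sym_traceless)
  moreover have "?r > 0" using b by simp
  ultimately have "sphere_of_dim Sym 4 ?c (sphere ?c ?r \<inter> ?V)"
    unfolding sphere_of_dim_def by blast
  moreover have "spike a b w \<in> sphere ?c ?r \<inter> ?V" if w: "norm w = 1" for w
  proof -
    have eq: "spike a b w = ?c + traceless (spike a b w)"
      by (simp add: traceless_def trace_spike[OF w] add_divide_distrib)
    have "dist ?c (spike a b w) = norm (traceless (spike a b w))"
      by (subst eq) (simp add: dist_norm norm_minus_commute)
    also have "\<dots> = ?r"
      unfolding norm_eq_sqrt_inner traceless_spike_moments(1)[OF w] ..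
    finally have "spike a b w \<in> sphere ?c ?r" by simp
    moreover have "traceless (spike a b w) \<in> Sym_traceless"
      using spike_in_Sym[of a b w]
      by (simp add: Sym_traceless_def trace_traceless) (simp add: traceless_def Sym_iff mat_def)
    ultimately show ?thesis using eq by blast
  qed
  then have "Orbit (spike a b v) \<subseteq> sphere ?c ?r \<inter> ?V" unfolding Orbit_spike[OF v] by blast
  ultimately show ?thesis by blast
qed

text \<open>Among symmetric matrices the orbit is cut out by the vanishing of the two-by-two minors
  of \<open>X - a E\<close>, which forces rank at most one, and by the linear equation fixing the
  trace of \<open>X - a E\<close> as \<open>b\<close>.\<close>

lemma Orbit_spike_algebraic:
  fixes v :: "real^3"
  assumes v: "norm v = 1"
  shows "algebraic_surface_in Sym (Orbit (spike a b v))"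
proof -
  define B where "B X = X - a *\<^sub>R mat 1" for X :: "real^3^3"
  define minor where "minor i j k l X = B X $ i $ j * B X $ k $ l - B X $ i $ l * B X $ k $ j"
    for i j k l X
  define P where "P = insert (\<lambda>X. trace (B X) - b) (range (\<lambda>(i, j, k, l). minor i j k l))"
  have entry: "real_polynomial_function (\<lambda>X. B X $ i $ j)" for i j
  proof -
    have "bounded_linear (\<lambda>X :: real^3^3. X $ i $ j)"
      by (rule bounded_linear_compose[OF bounded_linear_vec_nth bounded_linear_vec_nth])
    then show ?thesis
      unfolding B_def
      by (simp add: real_polynomial_function.intros(1) real_polynomial_function.intros(2)
          real_polynomial_function_diff)
  qed
  then have "real_polynomial_function (minor i j k l)" for i j k l
    unfolding minor_def by (intro real_polynomial_function_diff real_polynomial_function.intros(4))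
  moreover have "real_polynomial_function (\<lambda>X. trace (B X) - b)"
    unfolding trace_def sum_3
    by (intro real_polynomial_function_diff real_polynomial_function.intros(3) entry
        real_polynomial_function.intros(2))
  ultimately have poly: "\<forall>p\<in>P. real_polynomial_function p" by (auto simp: P_def)
  have zeros: "(\<forall>p\<in>P. p X = 0) \<longleftrightarrow> trace (B X) = b \<and> (\<forall>i j k l. minor i j k l X = 0)" for X
    by (auto simp: P_def)
  have "Orbit (spike a b v) = {X \<in> Sym. \<forall>p\<in>P. p X = 0}"
    unfolding Orbit_spike[OF v] zeros
  proof (intro Set.equalityI subsetI)
    fix X :: "real^3^3" assume "X \<in> {spike a b w | w. norm w = 1}"
    then obtain w :: "real^3" where w: "norm w = 1" "X = spike a b w" by blast
    then have B: "B X = b *\<^sub>R outer w" by (simp add: B_def spike_def)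
    then have "trace (B X) = b" using w(1) by (simp add: trace_scaleR trace_outer norm_eq_1)
    moreover have "minor i j k l X = 0" for i j k l by (simp add: minor_def B)
    ultimately show "X \<in> {X \<in> Sym. trace (B X) = b \<and> (\<forall>i j k l. minor i j k l X = 0)}"
      using spike_in_Sym[of a b w, folded w(2)] by simp
  next
    fix X :: "real^3^3" assume X: "X \<in> {X \<in> Sym. trace (B X) = b \<and> (\<forall>i j k l. minor i j k l X = 0)}"
    then have "B X \<in> Sym" by (auto simp: B_def Sym_iff mat_def)
    then obtain w where w: "norm w = 1" "B X = trace (B X) *\<^sub>R outer w"
      using X by (auto simp: minor_def elim: minors_zero_imp_outer)
    then have "X = spike a b w" using X by (simp add: spike_def B_def algebra_simps)
    then show "X \<in> {spike a b w | w. norm w = 1}" using w(1) by blast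
  qed
  with poly show ?thesis unfolding algebraic_surface_in_def by blast
qed

section \<open>The cone, homotheties and diagonal matrices\<close>

lemma diag3_eq_spike:
  shows "diag3 t t (-2 * t) = spike t (-3 * t) (axis 3 1)"
    and "diag3 t (-2 * t) t = spike t (-3 * t) (axis 2 1)"
    and "diag3 (-2 * t) t t = spike t (-3 * t) (axis 1 1)"
  \<comment> \<open>The simple eigenvalue \<open>-2 * t\<close> belongs to the axis vector, so the
    gap is \<open>-3 * t\<close>.\<close>
  by (simp_all add: diag3_def vec_eq_iff forall_3 axis_def)

lemma Orbit_diag3: "Orbit (diag3 1 1 (-2)) = {spike 1 (-3) w | w. norm w = 1}"
  using diag3_eq_spike(1)[of 1] by (simp add: Orbit_spike)

lemma \<M>\<^sub>0_cone: "\<M>\<^sub>0 = full_cone (Orbit (diag3 1 1 (-2)))"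
proof (intro Set.equalityI subsetI)
  fix X assume "X \<in> \<M>\<^sub>0"
  then obtain b v where v: "norm v = 1" "X = spike (- b / 3) b v" by (rule \<M>\<^sub>0_imp_spike)
  \<comment> \<open>The factor turns the gap \<open>-3\<close> into \<open>b\<close>; as
    \<open>b\<close> may have either sign, so may the factor.\<close>
  then have "X = (- b / 3) *\<^sub>R spike 1 (-3) v" by (auto simp: vec_eq_iff field_simps)
  with v(1) show "X \<in> full_cone (Orbit (diag3 1 1 (-2)))"
    unfolding full_cone_def Orbit_diag3 by blast
next
  fix X assume "X \<in> full_cone (Orbit (diag3 1 1 (-2)))"
  then obtain t w where w: "norm w = 1" "X = t *\<^sub>R spike 1 (-3) w"
    unfolding full_cone_def Orbit_diag3 by blast
  then have "X = spike (- (-3 * t) / 3) (-3 * t) w" by (simp add: vec_eq_iff algebra_simps)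
  then show "X \<in> \<M>\<^sub>0" using w(1) spike_in_\<M>\<^sub>0 by metis
qed

lemma Orbit_shift_homothety:
  assumes "A \<in> \<M>"
  shows "\<exists>b c. Orbit A = scalar_shift c ` homothety b ` Orbit (diag3 1 1 (-2))"
proof -
  obtain a b v where v: "norm v = 1" "A = spike a b v" using assms by (rule \<M>_imp_spike)
  \<comment> \<open>The homothety adjusts the gap from \<open>-3\<close> to \<open>b\<close> and
    moves the double eigenvalue to \<open>- b / 3\<close>; the shift then brings it to
    \<open>a\<close>. Scalar matrices have \<open>b = 0\<close> and use the homothety with factor
    zero.\<close>
  have eq: "spike a b w = scalar_shift (a + b / 3) (homothety (- b / 3) (spike 1 (-3) w))" for w :: "real^3"
    by (auto simp: scalar_shift_def homothety_def vec_eq_iff mat_def field_simps)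
  have "scalar_shift (a + b / 3) ` homothety (- b / 3) ` Orbit (diag3 1 1 (-2)) =
      {scalar_shift (a + b / 3) (homothety (- b / 3) (spike 1 (-3) w)) | w. norm w = 1}"
    unfolding Orbit_diag3 by blast
  then have "Orbit A = scalar_shift (a + b / 3) ` homothety (- b / 3) ` Orbit (diag3 1 1 (-2))"
    unfolding v(2) Orbit_spike[OF v(1)] by (simp only: eq)
  then show ?thesis by blast
qed

lemma diagonal_\<M>\<^sub>0:
  "{X \<in> \<M>\<^sub>0. diagonal_matrix X} =
    range (\<lambda>t. diag3 t t (-2 * t)) \<union> range (\<lambda>t. diag3 t (-2 * t) t) \<union> range (\<lambda>t. diag3 (-2 * t) t t)"
  (is "?L = ?R")
proof (intro Set.equalityI subsetI)
  fix X assume X: "X \<in> ?L"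
  then have "X \<in> \<M>\<^sub>0" by simp
  then obtain b v where v: "norm v = 1" "X = spike (- b / 3) b v" by (rule \<M>\<^sub>0_imp_spike)
  have off: "b * (v $ i * v $ j) = 0" if "i \<noteq> j" for i j
    using X that v(2) by (simp add: diagonal_matrix_def)
  \<comment> \<open>If \<open>b\<close> is nonzero, all products of distinct entries of
    \<open>v\<close> vanish, so \<open>v\<close> is an axis vector up to sign. The gap is written
    with \<open>- b / 3\<close> to match the parameter of \<open>diag3_eq_spike\<close>.\<close>
  have "\<exists>i. X = spike (- b / 3) (-3 * (- b / 3)) (axis i 1)"
  proof (cases "b = 0")
    case True
    then show ?thesis using v(2) by (simp add: spike_def)
  next
    case False
    obtain i where i: "v $ i \<noteq> 0" using unit_vec_nth_nonzero[OF v(1)] by blast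
    have "v = (v $ i) *\<^sub>R axis i 1"
      using off[of i] i False by (auto simp: vec_eq_iff axis_def)
    moreover from this have "(v $ i)\<^sup>2 = 1"
      using v(1) by (metis norm_axis_1 norm_scaleR mult.right_neutral abs_1 power2_abs power_one)
    ultimately have "X = spike (- b / 3) b (axis i 1)"
      using v(2) spike_scaleR by (metis mult_1)
    then show ?thesis by auto
  qed
  then obtain i where "X = spike (- b / 3) (-3 * (- b / 3)) (axis i 1)" by blast
  then show "X \<in> ?R" using exhaust_3[of i] unfolding diag3_eq_spike by blast
next
  fix X assume "X \<in> ?R"
  then obtain i t where X: "X = spike t (-3 * t) (axis i 1)"
    unfolding diag3_eq_spike by blast
  then have "X \<in> \<M>\<^sub>0" using spike_in_\<M>\<^sub>0[of "axis i 1" t "-3 * t"] by simp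
  moreover have "diagonal_matrix X" unfolding diagonal_matrix_def X by (simp add: axis_def)
  ultimately show "X \<in> ?L" by simp
qed

lemma line_through_0:
  assumes "\<And>t. f t = t *\<^sub>R (x :: 'a::euclidean_space)" "x \<noteq> 0"
  shows "subspace (range f) \<and> dim (range f) = 1"
proof -
  have "range f = span {x}" using assms(1) by (auto simp: span_singleton)
  then show ?thesis using assms(2) by simp
qed

section \<open>The projective plane\<close>

lemma RP2_span:
  assumes "x \<noteq> 0"
  shows "span {x} \<in> RP2"
  using assms by (simp add: RP2_def)

lemma RP2_imp_span:
  assumes "L \<in> RP2"
  obtains v where "norm v = 1" "L = span {v}"
proof -
  have L: "subspace L" "dim L = 1" using assms by (simp_all add: RP2_def)
  then obtain x where x: "x \<in> L" "x \<noteq> 0" by (metis dim_eq_0 subsetI singletonI zero_neq_one)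
  let ?v = "x /\<^sub>R norm x"
  have v: "?v \<in> L" "?v \<noteq> 0" "norm ?v = 1" using x L(1) by (simp_all add: subspace_scale)
  have "span {?v} = L"
    by (rule subspace_dim_equal) (use v L in \<open>simp_all add: span_minimal\<close>)
  with v(3) show ?thesis using that by blast
qed

lemma RP2_chart_dom:
  assumes "x \<noteq> 0"
  shows "span {x} \<in> fst (RP2_chart i j k) \<longleftrightarrow> x $ i \<noteq> 0"
  using RP2_span[OF assms] by (auto simp: RP2_chart_def span_singleton)

lemma RP2_chart_apply:
  assumes "x $ i \<noteq> 0"
  shows "snd (RP2_chart i j k) (span {x}) = aff_coord i j k x"
proof -
  have "(THE y. y \<in> span {x} \<and> y $ i = 1) = x /\<^sub>R x $ i"
  proof (rule the_equality)
    show "y = x /\<^sub>R x $ i" if "y \<in> span {x} \<and> y $ i = 1" for y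
      using that assms by (auto simp: span_singleton field_simps)
  qed (use assms in \<open>auto simp: span_singleton\<close>)
  then show ?thesis by (simp add: RP2_chart_def aff_coord_def divide_inverse mult.commute)
qed

lemma aff_coord_aff_vec_1: "{i, j, k} = UNIV \<Longrightarrow> aff_coord i j k (aff_vec i j k u) = u"
  using aff_coord_aff_vec[of i j k 1 u] by simp

lemma span_aff_vec_aff_coord:
  assumes "{i, j, k} = UNIV" "x $ i \<noteq> 0"
  shows "span {aff_vec i j k (aff_coord i j k x)} = span {x}"
  unfolding aff_vec_aff_coord[OF assms]
proof (intro Set.equalityI subsetI)
  fix y assume "y \<in> span {x}"
  then obtain c where "y = c *\<^sub>R x" by (auto simp: span_singleton)
  then have "y = (c * x $ i) *\<^sub>R (x /\<^sub>R x $ i)" using assms(2) by simp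
  then show "y \<in> span {x /\<^sub>R x $ i}" unfolding span_singleton by blast
qed (auto simp: span_singleton)

text \<open>Each affine chart is a bijection onto the whole plane, with \<open>u\<close> coming from
  the line spanned by \<open>aff_vec i j k u\<close>. This replaces \<open>inv_into\<close> by a
  formula in the coordinate changes.\<close>

lemma RP2_chart_inverse:
  assumes t: "{i, j, k} = UNIV" and c: "(V, \<psi>) = RP2_chart i j k"
  shows RP2_chart_aff_line: "span {aff_vec i j k u} \<in> V" "\<psi> (span {aff_vec i j k u}) = u"
    and RP2_chart_inj: "inj_on \<psi> V"
    and RP2_chart_inv: "inv_into V \<psi> u = span {aff_vec i j k u}"
    and RP2_chart_image: "\<psi> ` V = UNIV"
proof -
  have V: "V = fst (RP2_chart i j k)" "\<psi> = snd (RP2_chart i j k)" by (simp_all flip: c)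
  show l: "span {aff_vec i j k u} \<in> V" "\<psi> (span {aff_vec i j k u}) = u" for u
    by (simp_all add: V RP2_chart_dom RP2_chart_apply aff_coord_aff_vec_1[OF t])
  have r: "span {aff_vec i j k (\<psi> L)} = L" if L: "L \<in> V" for L
  proof -
    have "L \<in> RP2" using L V by (auto simp: RP2_chart_def)
    then obtain x where x: "norm x = 1" "L = span {x}" by (rule RP2_imp_span)
    then have "x $ i \<noteq> 0"
      using L V RP2_chart_dom[OF unit_vec_nonzero[OF x(1)], of i j k] by simp
    then show ?thesis by (simp add: V x(2) RP2_chart_apply span_aff_vec_aff_coord[OF t])
  qed
  show inj: "inj_on \<psi> V" by (rule inj_on_inverseI) (rule r)
  show "inv_into V \<psi> u = span {aff_vec i j k u}" using inv_into_f_f[OF inj l(1)] l(2) by simp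
  show "\<psi> ` V = UNIV" using l by (metis UNIV_eq_I image_eqI)
qed

lemma RP2_atlas_cases:
  assumes "c \<in> RP2_atlas"
  obtains i j k where "{i, j, k} = UNIV" "c = RP2_chart i j k"
proof -
  have "{1, 2, 3} = (UNIV :: 3 set)" "{2, 1, 3} = (UNIV :: 3 set)" "{3, 1, 2} = (UNIV :: 3 set)"
    unfolding UNIV_3 by auto
  then show ?thesis using assms that unfolding RP2_atlas_def by blast
qed

lemma ex_RP2_atlas: "\<exists>j k. RP2_chart i j k \<in> RP2_atlas"
  using exhaust_3[of i] unfolding RP2_atlas_def by blast

text \<open>In coordinates a change of charts takes \<open>aff_vec\<close> and divides by the new
  pivot coordinate; its domain is the open set where that coordinate is nonzero.\<close>

lemma smooth_atlas_RP2: "smooth_atlas RP2 RP2_atlas"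
proof -
  have "\<exists>c\<in>RP2_atlas. L \<in> fst c" if L: "L \<in> RP2" for L
  proof -
    obtain x where x: "norm x = 1" "L = span {x}" using L by (rule RP2_imp_span)
    obtain i where i: "x $ i \<noteq> 0" using unit_vec_nth_nonzero[OF x(1)] by blast
    obtain j k where "RP2_chart i j k \<in> RP2_atlas" using ex_RP2_atlas by blast
    moreover have "L \<in> fst (RP2_chart i j k)" 
      using x i RP2_chart_dom[OF unit_vec_nonzero[OF x(1)], of i j k] by simp
    ultimately show ?thesis by blast
  qed
  moreover have "fst c \<subseteq> RP2" if "c \<in> RP2_atlas" for c
    using that by (auto simp: RP2_atlas_def RP2_chart_def)
  ultimately have "(\<Union>(U, \<phi>)\<in>RP2_atlas. U) = RP2" by (fastforce simp: case_prod_beta)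
  moreover have "inj_on \<phi> U \<and> open (\<phi> ` U)" if c: "(U, \<phi>) \<in> RP2_atlas" for U \<phi>
  proof -
    obtain i j k where "{i, j, k} = UNIV" "(U, \<phi>) = RP2_chart i j k" using c by (rule RP2_atlas_cases)
    then show ?thesis by (simp add: RP2_chart_inj RP2_chart_image)
  qed
  moreover have "open (\<phi> ` (U \<inter> V)) \<and> smooth_on (\<phi> ` (U \<inter> V)) (\<psi> \<circ> inv_into U \<phi>)"
    if c: "(U, \<phi>) \<in> RP2_atlas" "(V, \<psi>) \<in> RP2_atlas" for U \<phi> V \<psi>
  proof -
    obtain i j k where t: "{i, j, k} = UNIV" and U: "(U, \<phi>) = RP2_chart i j k"
      using c(1) by (rule RP2_atlas_cases)
    obtain i' j' k' where t': "{i', j', k'} = UNIV" and V: "(V, \<psi>) = RP2_chart i' j' k'"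
      using c(2) by (rule RP2_atlas_cases)
    have V': "V = fst (RP2_chart i' j' k')" "\<psi> = snd (RP2_chart i' j' k')"
      by (simp_all flip: V)
    note U_facts = RP2_chart_inverse[OF t U]
    have mem: "span {aff_vec i j k u} \<in> V \<longleftrightarrow> aff_vec i j k u $ i' \<noteq> 0" for u
      by (simp add: V' RP2_chart_dom)
    have "\<phi> ` (U \<inter> V) = {u. span {aff_vec i j k u} \<in> V}"
      using U_facts(1,2) inv_into_f_f[OF U_facts(3)] unfolding U_facts(4)
      by (auto simp: image_iff) (metis IntI)
    then have im: "\<phi> ` (U \<inter> V) = {u \<in> UNIV. aff_vec i j k u $ i' \<noteq> 0}" by (simp add: mem)
    have C: "Cinf_on UNIV (aff_vec i j k)"
      using Cinf_on_aff_vec[OF Cinf_on_id[OF open_UNIV]] .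
    have o: "open (\<phi> ` (U \<inter> V))"
      unfolding im by (rule Cinf_on_open_neq_0[OF Cinf_on_vec_nth[OF C]])
    have "smooth_on (\<phi> ` (U \<inter> V)) (\<psi> \<circ> inv_into U \<phi>)"
    proof (rule smooth_onI)
      show "Cinf_on (\<phi> ` (U \<inter> V)) (\<lambda>u. aff_coord i' j' k' (aff_vec i j k u))"
        by (rule Cinf_on_aff_coord[OF Cinf_on_subset[OF C o]]) (auto simp: im)
      show "(\<psi> \<circ> inv_into U \<phi>) u = aff_coord i' j' k' (aff_vec i j k u)" if "u \<in> \<phi> ` (U \<inter> V)" for u
        using that unfolding im by (simp add: U_facts(4) V'(2) RP2_chart_apply)
    qed simp
    with o show ?thesis ..
  qed
  ultimately show ?thesis
    unfolding smooth_atlas_def Ball_def split_paired_All by simp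
qed

section \<open>Orbits as projective planes\<close>

lemma chart_Orbit:
  assumes v: "norm v = 1" and b: "b \<noteq> 0" and t: "{i, j, k} = UNIV"
  shows "chart_with_inverse (Orbit (spike a b v)) {X. pivot_row i a X $ i \<noteq> 0}
    (\<lambda>X. aff_coord i j k (pivot_row i a X)) UNIV (spike_param i j k a b)"
proof (rule chart_with_inverseI)
  \<comment> \<open>On one orbit \<open>a\<close> is a constant, so the pivot row is an affine
    function of the matrix.\<close>
  have C: "Cinf_on UNIV (pivot_row i a)"
    by (rule Cinf_on_pivot_row[OF Cinf_on_const Cinf_on_id]) simp_all
  have "open {X. pivot_row i a X $ i \<noteq> 0}"
    using Cinf_on_open_neq_0[OF Cinf_on_vec_nth[OF C]] by simp
  then show "Cinf_on {X. pivot_row i a X $ i \<noteq> 0} (\<lambda>X. aff_coord i j k (pivot_row i a X))"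
    by (intro Cinf_on_aff_coord Cinf_on_subset[OF C]) simp_all
  show "Cinf_on UNIV (spike_param i j k a b)"
    by (rule Cinf_on_spike_param[OF Cinf_on_const Cinf_on_const Cinf_on_id]) simp_all
  show "spike_param i j k a b u \<in> Orbit (spike a b v)" for u
    using spike_param_unit(1,2)[where i=i and j=j and k=k and u=u] unfolding Orbit_spike[OF v] by blast
  show "spike_param i j k a b u \<in> {X. pivot_row i a X $ i \<noteq> 0}" for u
    using b by (simp add: spike_param_def pivot_row_spike)
  show "aff_coord i j k (pivot_row i a (spike_param i j k a b u)) = u" for u
    by (rule aff_coord_spike_param[OF t b])
  show "spike_param i j k a b (aff_coord i j k (pivot_row i a X)) = X"
    if "X \<in> Orbit (spike a b v)" "X \<in> {X. pivot_row i a X $ i \<noteq> 0}" for X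
    using that b spike_param_aff_coord[OF t b]
    unfolding Orbit_spike[OF v] by (auto simp: pivot_row_spike)
qed simp

lemma ex_chart_Orbit:
  fixes v :: "real^3"
  assumes v: "norm v = 1" and b: "b \<noteq> 0" and X: "X \<in> Orbit (spike a b v)"
  shows "\<exists>W (\<phi> :: _ \<Rightarrow> real^2) V \<psi>. X \<in> W \<and> chart_with_inverse (Orbit (spike a b v)) W \<phi> V \<psi>"
proof -
  obtain w :: "real^3" where w: "norm w = 1" "X = spike a b w" using X unfolding Orbit_spike[OF v] by blast
  obtain i where i: "w $ i \<noteq> 0" using unit_vec_nth_nonzero[OF w(1)] by blast
  obtain j k where "{i, j, k} = UNIV" using ex_triple[of i] by blast
  note chart_Orbit[OF v b this, of a]
  moreover have "X \<in> {X. pivot_row i a X $ i \<noteq> 0}"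
    using i b by (simp add: w(2) pivot_row_spike)
  ultimately show ?thesis by (intro exI[of _ "{X. pivot_row i a X $ i \<noteq> 0}"] exI conjI)
qed

lemma smooth_submanifold_Orbit:
  fixes v :: "real^3"
  assumes "norm v = 1" "b \<noteq> 0"
  shows "smooth_submanifold 2 (Orbit (spike a b v))"
proof -
  have "smooth_submanifold DIM(real^2) (Orbit (spike a b v))"
    by (rule smooth_submanifoldI[OF ex_chart_Orbit[OF assms]]) simp_all
  then show ?thesis by simp
qed

text \<open>For the simple eigenvalue \<open>a + b\<close> of a spike this eigenspace is a line. It
  gives the map to the projective plane directly from the matrix, free of the choice of sign of
  \<open>v\<close>.\<close>

definition eigenline :: "real \<Rightarrow> real^3^3 \<Rightarrow> (real^3) set" where
  "eigenline \<mu> X = {x. X *v x = \<mu> *\<^sub>R x}"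

lemma eigenline_spike:
  assumes v: "norm v = 1" and b: "b \<noteq> 0"
  shows "eigenline (a + b) (spike a b v) = span {v}"
proof -
  have mult: "spike a b v *v x = a *\<^sub>R x + (b * (v \<bullet> x)) *\<^sub>R v" for x
  proof -
    have "outer v *v x = (v \<bullet> x) *\<^sub>R v"
      by (simp add: vec_eq_iff matrix_vector_mult_def inner_vec_def sum_distrib_left mult_ac)
    then show ?thesis
      by (simp add: spike_def matrix_vector_mult_add_rdistrib flip: scaleR_matrix_vector_assoc)
  qed
  have vv: "v \<bullet> v = 1" using v by (simp add: norm_eq_1)
  have "x \<in> eigenline (a + b) (spike a b v) \<longleftrightarrow> (v \<bullet> x) *\<^sub>R v = x" for x
  proof -
    have "x \<in> eigenline (a + b) (spike a b v) \<longleftrightarrow> b *\<^sub>R ((v \<bullet> x) *\<^sub>R v) = b *\<^sub>R x"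
      by (simp add: eigenline_def mult scaleR_add_left)
    then show ?thesis using b by (simp only: scaleR_cancel_left) simp
  qed
  moreover have "(v \<bullet> x) *\<^sub>R v = x \<longleftrightarrow> x \<in> span {v}" for x
    using vv by (auto simp: span_singleton intro: exI[of _ "v \<bullet> x"] dest: sym)
  ultimately show ?thesis by blast
qed

text \<open>Unit vectors on the same line differ by a sign, which cancels in \<open>outer\<close>;
  this gives injectivity of the map to lines.\<close>

lemma spike_eq_of_span_eq:
  assumes "norm v = 1" "norm w = 1" "span {v} = span {w}"
  shows "spike a b v = spike a b w"
proof -
  have "v \<in> span {w}" using assms(3) span_base[of v "{v}"] by simp
  then obtain c where c: "v = c *\<^sub>R w" by (auto simp: span_singleton)
  then have "\<bar>c\<bar> = 1" using assms(1,2) by simp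
  then have "c\<^sup>2 = 1" by (metis power2_abs power_one)
  then show ?thesis using c by (simp add: spike_scaleR)
qed

text \<open>The diffeomorphism sends a matrix to its eigenline for \<open>a + b\<close>. Read in an
  affine chart of the projective plane it is the rational chart of the orbit, and its inverse is
  \<open>spike_param\<close>.\<close>

lemma diffeomorphic_Orbit_RP2:
  fixes v :: "real^3"
  assumes v: "norm v = 1" and b: "b \<noteq> 0"
  shows "diffeomorphic (Orbit (spike a b v))
    (submanifold_charts (Orbit (spike a b v)) :: (real^3^3, real^2) chart set) RP2 RP2_atlas"
proof -
  define N where "N = Orbit (spike a b v)"
  let ?A = "submanifold_charts N :: (real^3^3, real^2) chart set" and ?f = "eigenline (a + b)"
  have N: "N = {spike a b w | w. norm w = 1}" unfolding N_def by (rule Orbit_spike[OF v])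
  have f: "?f (spike a b w) = span {w}" if "norm w = 1" for w
    by (rule eigenline_spike[OF that b])
  have inj: "inj_on ?f N"
    by (rule inj_onI) (auto simp: N f intro: spike_eq_of_span_eq)
  have surj: "?f ` N = RP2"
  proof (intro Set.equalityI subsetI)
    fix L assume "L \<in> ?f ` N"
    then obtain w where "norm w = 1" "L = span {w}" by (auto simp: N f)
    then show "L \<in> RP2" using RP2_span[OF unit_vec_nonzero] by simp
  next
    fix L assume "L \<in> RP2"
    then obtain w where w: "norm w = 1" "L = span {w}" by (rule RP2_imp_span)
    then show "L \<in> ?f ` N" unfolding N using f[OF w(1)] by blast
  qed
  have param_N: "spike_param i j k a b u \<in> N" for i j k u
    using spike_param_unit(1,2)[where i=i and j=j and k=k and u=u] unfolding N by blast
  have f_param: "?f (spike_param i j k a b u) = span {aff_vec i j k u}" for i j k u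
  proof -
    have "?f (spike_param i j k a b u) = span {aff_vec i j k u /\<^sub>R norm (aff_vec i j k u)}"
      unfolding spike_param_unit(1) by (rule f) (rule spike_param_unit(2))
    also have "\<dots> = span {aff_vec i j k u}"
      by (rule span_image_scale[of "{aff_vec i j k u}" "\<lambda>x. inverse (norm (aff_vec i j k u))", simplified])
    finally show ?thesis .
  qed
  have inv_f: "inv_into N ?f (span {aff_vec i j k u}) = spike_param i j k a b u" for i j k u
    using inv_into_f_f[OF inj param_N] f_param by metis
  have "smooth_map ?A RP2_atlas ?f"
  proof -
    have "open (\<phi> ` (U \<inter> ?f -` V)) \<and> smooth_on (\<phi> ` (U \<inter> ?f -` V)) (\<psi> \<circ> ?f \<circ> inv_into U \<phi>)"
      if U: "(U, \<phi>) \<in> ?A" and V: "(V, \<psi>) \<in> RP2_atlas" for U \<phi> V \<psi>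
    proof -
      obtain i j k where t: "{i, j, k} = UNIV" and c: "(V, \<psi>) = RP2_chart i j k"
        using V by (rule RP2_atlas_cases)
      have V': "V = fst (RP2_chart i j k)" "\<psi> = snd (RP2_chart i j k)" by (simp_all flip: c)
      have sub: "U \<subseteq> N" and \<phi>: "diffeo_betw \<phi> U (\<phi> ` U)" "open (\<phi> ` U)"
        using U openin_imp_subset by (auto simp: submanifold_charts_def)
      have injU: "inj_on \<phi> U" using \<phi> by (simp add: diffeo_betw_def bij_betw_def)
      note chart = chart_Orbit[OF v b t, of a, folded N_def]
      let ?W = "{X. pivot_row i a X $ i \<noteq> 0}"
      \<comment> \<open>The preimage of the affine chart domain under the eigenline map is the
        domain of the rational chart with the same pivot.\<close>
      have spike_V: "?f (spike a b w) \<in> V \<longleftrightarrow> spike a b w \<in> ?W" if w: "norm w = 1" for w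
        using b RP2_chart_dom[OF unit_vec_nonzero[OF w], of i j k]
        by (auto simp: f[OF w] V' pivot_row_spike)
      have dom: "U \<inter> ?f -` V = U \<inter> ?W" using sub spike_V by (auto simp: N)
      have "open ?W"
        using Cinf_on_open chart unfolding chart_with_inverse_def by blast
      then have "open (\<phi> ` (U \<inter> ?W))"
        by (intro diffeo_betw_open_image[OF \<phi>] openin_open_Int)
      moreover have "smooth_on (\<phi> ` (U \<inter> ?W)) (\<lambda>y. aff_coord i j k (pivot_row i a (inv_into U \<phi> y)))"
      proof (rule smooth_on_compose[where Y = "N \<inter> ?W"])
        show "smooth_on (\<phi> ` (U \<inter> ?W)) (inv_into U \<phi>)"
          by (rule smooth_on_subset[of "\<phi> ` U"]) (use \<phi>(1) in \<open>auto simp: diffeo_betw_def\<close>)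
        show "smooth_on (N \<inter> ?W) (\<lambda>X. aff_coord i j k (pivot_row i a X))"
          by (rule chart_with_inverse_smooth[OF chart])
        show "inv_into U \<phi> ` \<phi> ` (U \<inter> ?W) \<subseteq> N \<inter> ?W"
          using injU sub by (auto simp: inv_into_f_f)
      qed
      then have "smooth_on (\<phi> ` (U \<inter> ?W)) (\<psi> \<circ> ?f \<circ> inv_into U \<phi>)"
      proof (rule smooth_on_cong)
        fix y assume "y \<in> \<phi> ` (U \<inter> ?W)"
        then have "inv_into U \<phi> y \<in> N \<inter> ?W"
          using injU sub by (auto simp: inv_into_f_f)
        then obtain w where w: "norm w = 1" "inv_into U \<phi> y = spike a b w"
          and "pivot_row i a (spike a b w) $ i \<noteq> 0" by (auto simp: N)
        then have "w $ i \<noteq> 0" by (auto simp: pivot_row_spike)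
        then show "(\<psi> \<circ> ?f \<circ> inv_into U \<phi>) y = aff_coord i j k (pivot_row i a (inv_into U \<phi> y))"
          using b w f[OF w(1)] RP2_chart_apply[of w i j k]
          by (simp add: V' pivot_row_spike) (simp add: aff_coord_def)
      qed
      ultimately show ?thesis unfolding dom by blast
    qed
    then show ?thesis unfolding smooth_map_def Ball_def split_paired_All by simp
  qed
  moreover have "smooth_map RP2_atlas ?A (inv_into N ?f)"
  proof -
    have "open (\<psi> ` (V \<inter> inv_into N ?f -` U)) \<and>
        smooth_on (\<psi> ` (V \<inter> inv_into N ?f -` U)) (\<phi> \<circ> inv_into N ?f \<circ> inv_into V \<psi>)"
      if U: "(U, \<phi>) \<in> ?A" and V: "(V, \<psi>) \<in> RP2_atlas" for U \<phi> V \<psi>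
    proof -
      obtain i j k where t: "{i, j, k} = UNIV" and c: "(V, \<psi>) = RP2_chart i j k"
        using V by (rule RP2_atlas_cases)
      note V_facts = RP2_chart_inverse[OF t c]
      let ?s = "spike_param i j k a b"
      obtain W where W: "open W" "U = N \<inter> W" and \<phi>: "smooth_on U \<phi>"
        using U by (auto simp: submanifold_charts_def diffeo_betw_def openin_open)
      have Cs: "Cinf_on UNIV ?s"
        using chart_Orbit[OF v b t] unfolding chart_with_inverse_def by blast
      have "\<psi> ` (V \<inter> inv_into N ?f -` U) = {u. inv_into N ?f (span {aff_vec i j k u}) \<in> U}"
        using V_facts(1,2) inv_into_f_f[OF V_facts(3)] unfolding V_facts(4)
        by (auto simp: image_iff) (metis IntI vimageI)
      \<comment> \<open>In affine coordinates the inverse map is \<open>spike_param\<close>, which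
        always lands in the orbit; so only membership in the open set \<open>W\<close> remains as a
        condition.\<close>
      then have im: "\<psi> ` (V \<inter> inv_into N ?f -` U) = UNIV \<inter> ?s -` W"
        using param_N W(2) by (auto simp: inv_f)
      then have o: "open (\<psi> ` (V \<inter> inv_into N ?f -` U))"
        using continuous_open_preimage[OF Cinf_on_continuous[OF Cs] open_UNIV W(1)] by simp
      have "smooth_on (UNIV \<inter> ?s -` W) (\<lambda>u. \<phi> (?s u))"
      proof (rule smooth_on_compose[OF _ \<phi>])
        show "smooth_on (UNIV \<inter> ?s -` W) ?s" by (rule smooth_onI[OF Cs]) simp_all
      qed (use param_N W(2) in auto)
      then have "smooth_on (UNIV \<inter> ?s -` W) (\<phi> \<circ> inv_into N ?f \<circ> inv_into V \<psi>)"
        by (rule smooth_on_cong) (simp add: V_facts(4) inv_f)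
      with o show ?thesis by (simp add: im)
    qed
    then show ?thesis unfolding smooth_map_def Ball_def split_paired_All by simp
  qed
  moreover have "smooth_atlas N ?A"
    unfolding N_def by (rule smooth_atlas_submanifold_charts) (rule ex_chart_Orbit[OF v b])
  moreover have "bij_betw ?f N RP2" using inj surj by (rule bij_betw_imageI)
  ultimately show ?thesis
    unfolding diffeomorphic_def N_def[symmetric] using smooth_atlas_RP2
    by (intro conjI exI[of _ ?f])
qed

lemma nonscalar_orbit:
  assumes "A \<in> \<M> - scalar_matrices"
  obtains a b and v :: "real^3" where "norm v = 1" "b \<noteq> 0" "A = spike a b v"
proof -
  have "A \<in> \<M>" using assms by simp
  then obtain a b v where v: "norm v = 1" "A = spike a b v" by (rule \<M>_imp_spike)
  have "A \<in> nonscalar" using assms by (simp add: nonscalar_eq)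
  with v show ?thesis using that spike_nonscalar by metis
qed

lemma diagonal_lines:
  defines "L1 \<equiv> range (\<lambda>t. diag3 t t (-2 * t))" and "L2 \<equiv> range (\<lambda>t. diag3 t (-2 * t) t)"
    and "L3 \<equiv> range (\<lambda>t. diag3 (-2 * t) t t)"
  shows "\<forall>L \<in> {L1, L2, L3}. subspace L \<and> dim L = 1"
    and "L1 \<inter> L2 = {0}" "L1 \<inter> L3 = {0}" "L2 \<inter> L3 = {0}"
proof -
  have eq: "diag3 a b c = diag3 a' b' c' \<longleftrightarrow> a = a' \<and> b = b' \<and> c = c'"
    and zero: "diag3 a b c = 0 \<longleftrightarrow> a = 0 \<and> b = 0 \<and> c = 0"
    and scale: "s *\<^sub>R diag3 a b c = diag3 (s * a) (s * b) (s * c)" for a b c a' b' c' s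
    by (auto simp: diag3_def vec_eq_iff forall_3 vector_3)
  have "subspace L1 \<and> dim L1 = 1"
    unfolding L1_def by (rule line_through_0[of _ "diag3 1 1 (-2)"]) (simp_all add: eq zero scale)
  moreover have "subspace L2 \<and> dim L2 = 1"
    unfolding L2_def by (rule line_through_0[of _ "diag3 1 (-2) 1"]) (simp_all add: eq zero scale)
  moreover have "subspace L3 \<and> dim L3 = 1"
    unfolding L3_def by (rule line_through_0[of _ "diag3 (-2) 1 1"]) (simp_all add: eq zero scale)
  ultimately show lines: "\<forall>L \<in> {L1, L2, L3}. subspace L \<and> dim L = 1" by simp
  have 0: "0 \<in> L1" "0 \<in> L2" "0 \<in> L3" using lines by (simp_all add: subspace_0)
  have zero': "diag3 a b c = 0" if "a = 0" "b = 0" "c = 0" for a b c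
    using that zero by simp
  show "L1 \<inter> L2 = {0}" "L1 \<inter> L3 = {0}" "L2 \<inter> L3 = {0}"
    using 0 by (auto simp: L1_def L2_def L3_def eq intro!: zero')
qed

theorem mainTheorem3:
  shows
    \<comment> \<open>(1)\<close>
    "singular_points \<M> = scalar_matrices \<and>
     (\<forall>A\<in>\<M>. regular_point \<M> A \<longrightarrow> regular_point_dim 4 \<M> A) \<and>
     \<comment> \<open>(2)\<close>
     straight_cylinder_over \<M>\<^sub>0 (mat 1) \<M> \<and>
     surface_of_dim 3 \<M>\<^sub>0 \<and>
     (\<exists>V. subspace V \<and> V \<subseteq> Sym \<and> dim V = 5 \<and> \<M>\<^sub>0 \<subseteq> V) \<and>
     \<comment> \<open>(2.1)\<close>
     \<M>\<^sub>0 = full_cone (Orbit (diag3 1 1 (-2))) \<and>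
     smooth_submanifold 2 (Orbit (diag3 1 1 (-2))) \<and>
     (\<exists>S. sphere_of_dim Sym 4 0 S \<and> Orbit (diag3 1 1 (-2)) \<subseteq> S) \<and>
     \<comment> \<open>(2.2)\<close>
     (\<forall>A \<in> \<M> - scalar_matrices.
        smooth_submanifold 2 (Orbit A) \<and>
        algebraic_surface_in Sym (Orbit A) \<and>
        (\<exists>c S. sphere_of_dim Sym 4 c S \<and> Orbit A \<subseteq> S) \<and>
        diffeomorphic (Orbit A) (submanifold_charts (Orbit A) :: (real^3^3, real^2) chart set)
          RP2 RP2_atlas) \<and>
     \<comment> \<open>(3)\<close>
     (\<forall>A\<in>\<M>. \<exists>b c. Orbit A = scalar_shift c ` homothety b ` Orbit (diag3 1 1 (-2))) \<and>
     \<comment> \<open>(4)\<close>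
     (let L1 = range (\<lambda>t. diag3 t t (-2 * t));
          L2 = range (\<lambda>t. diag3 t (-2 * t) t);
          L3 = range (\<lambda>t. diag3 (-2 * t) t t)
      in {X \<in> \<M>\<^sub>0. diagonal_matrix X} = L1 \<union> L2 \<union> L3 \<and>
         (\<forall>L \<in> {L1, L2, L3}. subspace L \<and> dim L = 1) \<and>
         L1 \<inter> L2 = {0} \<and> L1 \<inter> L3 = {0} \<and> L2 \<inter> L3 = {0})"
proof -
  let ?D = "diag3 1 1 (-2)" and ?e = "axis 3 1 :: real^3"
  have D: "?D = spike 1 (-3) ?e" using diag3_eq_spike(1)[of 1] by simp
  have e: "norm ?e = 1" by simp
  \<comment> \<open>A regular point is not scalar, and the nonscalar points have charts of dimension
    4.\<close>
  have "\<forall>A\<in>\<M>. regular_point \<M> A \<longrightarrow> regular_point_dim 4 \<M> A"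
    using regular_point_dim_\<M> scalar_not_regular by (fastforce simp: scalar_matrices_def)
  moreover have "\<exists>V. subspace V \<and> V \<subseteq> Sym \<and> dim V = 5 \<and> \<M>\<^sub>0 \<subseteq> V"
    by (intro exI[of _ Sym_traceless] conjI subspace_Sym_traceless dim_Sym_traceless)
      (auto simp: Sym_traceless_def \<M>\<^sub>0_def \<M>_def)
  moreover have "smooth_submanifold 2 (Orbit ?D)"
    unfolding D by (rule smooth_submanifold_Orbit) simp_all
  moreover have "\<exists>S. sphere_of_dim Sym 4 0 S \<and> Orbit ?D \<subseteq> S"
    \<comment> \<open>With \<open>a = 1\<close> and \<open>b = -3\<close> the center
      \<open>(a + b / 3) E\<close> is zero.\<close>
    using Orbit_spike_on_sphere[OF e, of "-3" 1] unfolding D by simp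
  moreover have "\<forall>A \<in> \<M> - scalar_matrices.
        smooth_submanifold 2 (Orbit A) \<and>
        algebraic_surface_in Sym (Orbit A) \<and>
        (\<exists>c S. sphere_of_dim Sym 4 c S \<and> Orbit A \<subseteq> S) \<and>
        diffeomorphic (Orbit A) (submanifold_charts (Orbit A) :: (real^3^3, real^2) chart set)
          RP2 RP2_atlas"
  proof
    fix A assume "A \<in> \<M> - scalar_matrices"
    then obtain a b and v :: "real^3" where v: "norm v = 1" "b \<noteq> 0" "A = spike a b v"
      by (rule nonscalar_orbit)
    show "smooth_submanifold 2 (Orbit A) \<and>
        algebraic_surface_in Sym (Orbit A) \<and>
        (\<exists>c S. sphere_of_dim Sym 4 c S \<and> Orbit A \<subseteq> S) \<and>
        diffeomorphic (Orbit A) (submanifold_charts (Orbit A) :: (real^3^3, real^2) chart set)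
          RP2 RP2_atlas"
      unfolding v(3)
      by (intro conjI exI[of _ "(a + b / 3) *\<^sub>R mat 1"] smooth_submanifold_Orbit
          Orbit_spike_algebraic Orbit_spike_on_sphere diffeomorphic_Orbit_RP2 v(1,2))
  qed
  moreover have "\<forall>A\<in>\<M>. \<exists>b c. Orbit A = scalar_shift c ` homothety b ` Orbit ?D"
    using Orbit_shift_homothety by blast
  ultimately show ?thesis
    unfolding Let_def
    by (intro conjI singular_points_\<M> straight_cylinder_\<M> surface_of_dim_\<M>\<^sub>0 \<M>\<^sub>0_cone
        diagonal_\<M>\<^sub>0 diagonal_lines)
qed

end
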